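(* Let $A_0 \in M_2$ and let either $A = A_0 \in M_2$ or $A = A_0 \oplus [\mu] \in M_3$ for some $\mu \in \mathbb{C}$. Let $\mathcal{S} = \mathrm{span}\{I, A, A^*\}$, where $I$ is the identity matrix of the same size as $A$. Let $\mathcal{H}$ be a complex Hilbert space, let $B \in \mathcal{B}(\mathcal{H})$, and let $\Phi : \mathcal{S} \to \mathcal{B}(\mathcal{H})$ be the linear map given by $$\Phi(aI + bA + cA^* ) = aI_{\mathcal{H}} + bB + cB^* \quad \text{for all } a, b, c \in \mathbb{C},$$ where it is assumed that this formula gives a well-defined map. Then $\Phi$ is positive if and only if $\Phi$ is completely positive.
   Context: $\mathcal{B}(\mathcal{H})$ denotes the algebra of bounded linear operators on a complex Hilbert space $\mathcal{H}$, and $M_n$ denotes the algebra of $n\times n$ complex matrices, identified with $\mathcal{B}(\mathbb{C}^n)$. $A_0 \oplus [\mu]$ is the block diagonal matrix with diagonal blocks $A_0$ and the $1 \times 1$ matrix $[\mu]$. An operator system in $\mathcal{B}(\mathcal{K})$ is a self-adjoint linear subspace of $\mathcal{B}(\mathcal{K})$ containing the identity $I_{\mathcal{K}}$; the space $\mathcal{S}$ in the claim is one. A linear map $\Phi$ from an operator system $\mathcal{S} \subseteq \mathcal{B}(\mathcal{K})$ to $\mathcal{B}(\mathcal{H})$ is positive if $\Phi(T)$ is positive semi-definite for every positive semi-definite $T \in \mathcal{S}$. It is completely positive if for every integer $k \ge 1$ the map $I_k \otimes \Phi : M_k(\mathcal{S}) \to M_k(\mathcal{B}(\mathcal{H}))$,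 $(T_{ij}) \mapsto (\Phi(T_{ij}))$, is positive. Here $M_k(\mathcal{S})$ is the space of $k \times k$ matrices with entries in $\mathcal{S}$, regarded as operators on $\mathcal{K}^k$, and $M_k(\mathcal{B}(\mathcal{H}))$ is regarded as $\mathcal{B}(\mathcal{H}^k)$. *)

theory Defs
  imports "HOL-Analysis.Analysis"
begin

section \<open>Complex vector spaces and complex Hilbert spaces\<close>

class scaleC =
  fixes scaleC :: "complex \<Rightarrow> 'a \<Rightarrow> 'a"  (infixr \<open>*\<^sub>C\<close> 75)

class complex_vector = ab_group_add + scaleC +
  assumes scaleC_add_right: "a *\<^sub>C (x + y) = a *\<^sub>C x + a *\<^sub>C y"
    and scaleC_add_left: "(a + b) *\<^sub>C x = a *\<^sub>C x + b *\<^sub>C x"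
    and scaleC_scaleC: "a *\<^sub>C b *\<^sub>C x = (a * b) *\<^sub>C x"
    and scaleC_one: "1 *\<^sub>C x = x"

global_interpretation complex_vector:
  vector_space "scaleC :: complex \<Rightarrow> 'a \<Rightarrow> 'a::complex_vector"
  defines cspan = complex_vector.span
  by standard (simp_all add: scaleC_add_right scaleC_add_left scaleC_scaleC scaleC_one)

text \<open>
  The inner product \<open>cinner\<close> is linear in the first argument. A complex Hilbert space is
  also a real Hilbert space for the real part of \<open>cinner\<close>, so that the norm
  \<open>norm x = sqrt (inner x x)\<close>, completeness and \<open>bounded_linear\<close> are those of the library;
  positive definiteness of \<open>cinner\<close> follows from that of \<open>inner\<close>.
\<close>

class chilbert_space = complex_vector + real_inner + complete_space +
  fixes cinner :: "'a \<Rightarrow> 'a \<Rightarrow> complex"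
  assumes scaleC_of_real: "complex_of_real r *\<^sub>C x = r *\<^sub>R x"
    and cinner_add_left: "cinner (x + y) z = cinner x z + cinner y z"
    and cinner_scaleC_left: "cinner (a *\<^sub>C x) y = a * cinner x y"
    and cinner_commute: "cinner x y = cnj (cinner y x)"
    and inner_eq_Re_cinner: "inner x y = Re (cinner x y)"

instantiation complex :: chilbert_space
begin

definition scaleC_complex :: "complex \<Rightarrow> complex \<Rightarrow> complex"
  where "scaleC_complex a x = a * x"

definition cinner_complex :: "complex \<Rightarrow> complex \<Rightarrow> complex"
  where "cinner_complex x y = x * cnj y"

instance
  by standard
    (simp_all add: scaleC_complex_def cinner_complex_def algebra_simps scaleR_conv_of_real
      inner_complex_def)

end

instantiation vec :: (complex_vector, finite) complex_vector
begin

definition scaleC_vec :: "complex \<Rightarrow> 'a ^ 'b \<Rightarrow> 'a ^ 'b"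
  where "scaleC_vec a x = (\<chi> i. a *\<^sub>C x $ i)"

instance
  by standard
    (simp_all add: scaleC_vec_def vec_eq_iff scaleC_add_right scaleC_add_left scaleC_scaleC
      scaleC_one)

end

instantiation vec :: (chilbert_space, finite) chilbert_space
begin

definition cinner_vec :: "'a ^ 'b \<Rightarrow> 'a ^ 'b \<Rightarrow> complex"
  where "cinner_vec x y = (\<Sum>i\<in>UNIV. cinner (x $ i) (y $ i))"

instance
proof
  fix r a and x y z :: "'a ^ 'b"
  show "complex_of_real r *\<^sub>C x = r *\<^sub>R x"
    by (simp add: scaleC_vec_def vec_eq_iff scaleC_of_real)
  show "cinner (x + y) z = cinner x z + cinner y z"
    by (simp add: cinner_vec_def cinner_add_left sum.distrib)
  show "cinner (a *\<^sub>C x) y = a * cinner x y"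
    by (simp add: cinner_vec_def scaleC_vec_def cinner_scaleC_left sum_distrib_left)
  show "cinner x y = cnj (cinner y x)"
    unfolding cinner_vec_def cnj_sum by (rule sum.cong) (auto intro: cinner_commute)
  show "inner x y = Re (cinner x y)"
    by (simp add: cinner_vec_def inner_vec_def inner_eq_Re_cinner)
qed

end


section \<open>Bounded operators, adjoints and positivity\<close>

definition bounded_clinear :: "('a::chilbert_space \<Rightarrow> 'b::chilbert_space) \<Rightarrow> bool"
  where "bounded_clinear T \<longleftrightarrow> bounded_linear T \<and> (\<forall>a x. T (a *\<^sub>C x) = a *\<^sub>C T x)"

definition cadjoint :: "('a::chilbert_space \<Rightarrow> 'a) \<Rightarrow> ('a \<Rightarrow> 'a)"
  where "cadjoint T = (SOME T'. \<forall>x y. cinner (T x) y = cinner x (T' y))"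

definition positive_op :: "('a::chilbert_space \<Rightarrow> 'a) \<Rightarrow> bool"
  where "positive_op T \<longleftrightarrow> (\<forall>x. cinner (T x) x \<in> \<real>\<^sub>\<ge>\<^sub>0)"

text \<open>
  Elements of the \<open>k\<close>-fold direct sum of a Hilbert space are represented by functions on
  \<open>nat\<close>, of which only the values at \<open>0, \<dots>, k - 1\<close> matter; a \<open>k \<times> k\<close> matrix of operators
  by a function of two indices.
\<close>

definition block_op :: "nat \<Rightarrow> (nat \<Rightarrow> nat \<Rightarrow> 'a \<Rightarrow> 'a) \<Rightarrow> (nat \<Rightarrow> 'a) \<Rightarrow> nat \<Rightarrow> 'a::chilbert_space"
  where "block_op k T x = (\<lambda>i. \<Sum>j<k. T i j (x j))"

definition block_cinner :: "nat \<Rightarrow> (nat \<Rightarrow> 'a) \<Rightarrow> (nat \<Rightarrow> 'a::chilbert_space) \<Rightarrow> complex"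
  where "block_cinner k x y = (\<Sum>i<k. cinner (x i) (y i))"

definition positive_block :: "nat \<Rightarrow> (nat \<Rightarrow> nat \<Rightarrow> 'a::chilbert_space \<Rightarrow> 'a) \<Rightarrow> bool"
  where "positive_block k T \<longleftrightarrow> (\<forall>x. block_cinner k (block_op k T x) x \<in> \<real>\<^sub>\<ge>\<^sub>0)"


section \<open>Positive and completely positive maps on spaces of matrices\<close>

definition positive_map ::
    "(complex ^ 'n ^ 'n) set \<Rightarrow> (complex ^ 'n ^ 'n \<Rightarrow> 'h::chilbert_space \<Rightarrow> 'h) \<Rightarrow> bool"
  where "positive_map S \<Phi> \<longleftrightarrow> (\<forall>T\<in>S. positive_op ((*v) T) \<longrightarrow> positive_op (\<Phi> T))"

definition completely_positive_map ::
    "(complex ^ 'n ^ 'n) set \<Rightarrow> (complex ^ 'n ^ 'n \<Rightarrow> 'h::chilbert_space \<Rightarrow> 'h) \<Rightarrow> bool"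
  where "completely_positive_map S \<Phi> \<longleftrightarrow>
    (\<forall>k\<ge>1. \<forall>T :: nat \<Rightarrow> nat \<Rightarrow> complex ^ 'n ^ 'n.
      (\<forall>i<k. \<forall>j<k. T i j \<in> S) \<longrightarrow>
      positive_block k (\<lambda>i j. (*v) (T i j)) \<longrightarrow>
      positive_block k (\<lambda>i j. \<Phi> (T i j)))"

definition conj_transpose :: "complex ^ 'n ^ 'm \<Rightarrow> complex ^ 'm ^ 'n"
  where "conj_transpose A = map_matrix cnj (transpose A)"

definition op_system :: "complex ^ 'n ^ 'n \<Rightarrow> (complex ^ 'n ^ 'n) set"
  where "op_system A = cspan {mat 1, A, conj_transpose A}"

text \<open>
  A \<open>\<Phi>\<close> with the following property exists if and only if its defining formula is
  well-defined; its values outside \<open>op_system A\<close> are arbitrary.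
\<close>

definition induced_map ::
    "complex ^ 'n ^ 'n \<Rightarrow> ('h::chilbert_space \<Rightarrow> 'h) \<Rightarrow> (complex ^ 'n ^ 'n \<Rightarrow> 'h \<Rightarrow> 'h) \<Rightarrow> bool"
  where "induced_map A B \<Phi> \<longleftrightarrow>
    (\<forall>a b c. \<Phi> (a *\<^sub>C mat 1 + b *\<^sub>C A + c *\<^sub>C conj_transpose A) =
      (\<lambda>x. a *\<^sub>C x + b *\<^sub>C B x + c *\<^sub>C cadjoint B x))"

definition direct_sum_scalar :: "complex ^ 2 ^ 2 \<Rightarrow> complex \<Rightarrow> complex ^ 3 ^ 3"
  where "direct_sum_scalar A \<mu> = vector
    [vector [A $ 1 $ 1, A $ 1 $ 2, 0],
     vector [A $ 2 $ 1, A $ 2 $ 2, 0],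
     vector [0,         0,         \<mu>]]"


section \<open>Existence of adjoints\<close>

lemma riesz_real:
  fixes f :: "'a::{real_inner,complete_space} \<Rightarrow> real"
  assumes "bounded_linear f"
  shows "\<exists>u. \<forall>x. f x = inner x u"
proof -
  interpret f: bounded_linear f by fact
  define F where "F x = inner x x / 2 - f x" for x
  obtain K where K: "\<And>x. norm (f x) \<le> norm x * K" using f.bounded by blast
  have low: "- (K\<^sup>2 / 2) \<le> F x" for x
  proof -
    have "f x \<le> norm x * K" using K[of x] by simp
    moreover have "0 \<le> (norm x - K)\<^sup>2" by simp
    ultimately show ?thesis
      unfolding F_def power2_norm_eq_inner[symmetric] by (simp add: power2_diff)
  qed
  define m where "m = (INF x. F x)"
  have bdd: "bdd_below (range F)" using low by (intro bdd_belowI2)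
  have m_le: "m \<le> F x" for x unfolding m_def using bdd by (rule cINF_lower) simp
  have "\<exists>x. F x < m + 1 / real (Suc n)" for n
  proof -
    have "m < m + 1 / real (Suc n)" by (simp del: of_nat_Suc)
    then show ?thesis unfolding m_def using cINF_less_iff[OF UNIV_not_empty bdd] by blast
  qed
  then obtain X where X: "\<And>n. F (X n) < m + 1 / real (Suc n)" by metis
  have par: "(norm (x - y))\<^sup>2 \<le> 4 * (F x + F y - 2 * m)" for x y
  proof -
    have "F x + F y - 2 * F ((1/2) *\<^sub>R (x + y)) = (norm (x - y))\<^sup>2 / 4"
      unfolding F_def power2_norm_eq_inner f.scaleR f.add
      by (simp add: inner_add_left inner_add_right inner_diff_left inner_diff_right
          inner_commute field_simps)
    then show ?thesis using m_le[of "(1/2) *\<^sub>R (x + y)"] by argo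
  qed
  have "Cauchy X"
  proof (rule metric_CauchyI)
    fix e :: real assume "0 < e"
    then obtain N where N: "1 / real (Suc N) < e\<^sup>2 / 8"
      using nat_approx_posE[of "e\<^sup>2 / 8"] by auto
    have "dist (X i) (X j) < e" if "N \<le> i" "N \<le> j" for i j
    proof -
      have "1 / real (Suc i) \<le> 1 / real (Suc N)" "1 / real (Suc j) \<le> 1 / real (Suc N)"
        using that by (simp_all add: frac_le)
      then have "(norm (X i - X j))\<^sup>2 < e\<^sup>2"
        using par[of "X i" "X j"] X[of i] X[of j] N by argo
      then show ?thesis using \<open>0 < e\<close> by (simp add: dist_norm power_less_imp_less_base)
    qed
    then show "\<exists>M. \<forall>i\<ge>M. \<forall>j\<ge>M. dist (X i) (X j) < e" by blast
  qed
  then obtain u where u: "X \<longlonglongrightarrow> u" using Cauchy_convergent convergent_def by blast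
  have "(\<lambda>n. F (X n)) \<longlonglongrightarrow> F u"
    unfolding F_def by (intro tendsto_intros f.tendsto u) simp
  moreover have "(\<lambda>n. m + 1 / real (Suc n)) \<longlonglongrightarrow> m + 0"
    by (intro tendsto_intros LIMSEQ_inverse_real_of_nat[unfolded inverse_eq_divide])
  ultimately have "F u \<le> m + 0"
    by (rule LIMSEQ_le) (use X less_imp_le in blast)
  then have min: "F u \<le> F x" for x using m_le[of x] by linarith
  have "f h = inner h u" for h
  proof -
    define d where "d = inner u h - f h"
    have "0 \<le> t * d + t\<^sup>2 * (inner h h / 2)" for t
      using min[of "u + t *\<^sub>R h"] unfolding F_def d_def f.add f.scaleR
      by (simp add: algebra_simps inner_commute power2_eq_square)
    note * = this
    have "d = 0"
    proof (cases "inner h h = 0")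
      case True
      then show ?thesis using *[of 1] *[of "-1"] by simp
    next
      case False
      then have "0 < inner h h" by (simp add: order_less_le)
      then have "- (d\<^sup>2 / (2 * inner h h)) \<ge> 0"
        using *[of "- d / inner h h"] by (simp add: field_simps power2_eq_square)
      then have "d\<^sup>2 / (2 * inner h h) \<le> 0" by simp
      then show ?thesis using \<open>0 < inner h h\<close> by (simp add: divide_le_0_iff)
    qed
    then show ?thesis by (simp add: d_def inner_commute)
  qed
  then show ?thesis by blast
qed

lemma cadjoint_works:
  fixes T :: "'a::chilbert_space \<Rightarrow> 'a"
  assumes "bounded_clinear T"
  shows "cinner (T x) y = cinner x (cadjoint T y)"
proof -
  have bl: "bounded_linear T" and sc: "\<And>a x. T (a *\<^sub>C x) = a *\<^sub>C T x"
    using assms by (auto simp: bounded_clinear_def)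
  have "\<exists>u. \<forall>x. inner (T x) y = inner x u" for y
    by (rule riesz_real) (intro bounded_linear_inner_left_comp bl)
  then obtain T' where T': "\<And>x y. inner (T x) y = inner x (T' y)" by metis
  have "cinner (T x) y = cinner x (T' y)" for x y
    using T'[of x y] T'[of "\<i> *\<^sub>C x" y]
    by (simp add: complex_eq_iff sc inner_eq_Re_cinner cinner_scaleC_left)
  then have "\<exists>T'. \<forall>x y. cinner (T x) y = cinner x (T' y)" by blast
  then show ?thesis unfolding cadjoint_def by (rule someI2_ex) blast
qed

end

theory Submission
  imports Defs "HOL-Library.Function_Algebras" "HOL-Computational_Algebra.Fundamental_Theorem_Algebra"
begin

text \<open>
  Complete positivity trivially implies positivity. For the converse write an element of
  \<open>M\<^sub>k(S)\<close> as \<open>P \<otimes> I + Y \<otimes> A + Z \<otimes> A*\<close>; passing to Hermitian parts, \<open>P\<close> is Hermitian and \<open>Z =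
  Y*\<close>. A positive map sends a tensor \<open>v v* \<otimes> Q\<close> with \<open>Q\<close> positive in \<open>S\<close> to a positive
  operator, so it suffices to approximate every positive element by sums of such tensors. This
  is done in a slightly perturbed system, and the perturbation is then removed.

  Every matrix \<open>A\<^sub>0\<close> has equal diagonal entries in a suitable orthonormal basis
  (\<open>equal_diagonal_basis\<close>), \<open>A\<^sub>0 = [[\<alpha>, \<beta>], [\<gamma>, \<alpha>]]\<close>. The case \<open>A = A\<^sub>0\<close> amounts to the case \<open>A
  = A\<^sub>0 \<oplus> [\<alpha>]\<close>, as the additional positivity condition is implied by that on \<open>A\<^sub>0\<close>. Let \<open>\<bar>\<gamma>\<bar> \<le>
  \<bar>\<beta>\<bar>\<close>. Increasing \<open>\<bar>\<beta>\<bar>\<close> a little enlarges the numerical range of \<open>A\<close>, so that the map sending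
  the perturbed \<open>A\<close> to the same operator \<open>B\<close> is still positive, and makes \<open>\<bar>\<gamma>\<bar> \<noteq> \<bar>\<beta>\<bar>\<close>; a small
  multiple of the identity added to the given positive element keeps it positive definite
  (\<open>equal_diagonal_positive\<close>). When \<open>\<bar>\<gamma>\<bar> \<noteq> \<bar>\<beta>\<bar>\<close>, the matrices \<open>I, A, A*\<close> span the same space
  as \<open>I, E, E*\<close> with \<open>E = E\<^sub>1\<^sub>2 \<oplus> [\<nu>]\<close> for some \<open>\<nu>\<close>.

  For this system a positive element consists of the block Toeplitz matrix \<open>[[P, X], [X*, P]]
  \<ge> 0\<close> subject to \<open>P + \<nu> X + cnj \<nu> X* \<ge> 0\<close>, and \<open>I + z E + cnj z E*\<close> is positive for the
  unimodular \<open>z\<close> with \<open>0 \<le> 1 + 2 Re (\<nu> z)\<close>. In the positive definite case the required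
  decomposition is exact (\<open>toeplitz_decomposition\<close>): choose a unimodular \<open>z\<^sub>0\<close> on the line \<open>1 +
  2 Re (\<nu> z) = 0\<close> (any unimodular \<open>z\<^sub>0\<close>, if this line misses the circle) and subtract the
  largest \<open>R \<otimes> (1, cnj z\<^sub>0)(1, cnj z\<^sub>0)*\<close> below the Toeplitz matrix, a Schur complement. What
  remains is of the form \<open>[[P', X'], [X'*, P']]\<close> with \<open>P' > 0\<close> and of rank \<open>k\<close>, so that \<open>X'\<close>
  is a unitary operator relative to the inner product \<open>P'\<close>; if \<open>z\<^sub>0\<close> lies on the line, then \<open>P
  + \<nu> X + cnj \<nu> X*\<close> is unchanged, and if the line misses the circle, then it imposes nothing.
  Diagonalising that unitary operator gives the remaining terms of the sum.
\<close>

section \<open>Finite-dimensional complex linear algebra\<close>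

lemma linear_relation_of_large_family:
  fixes v :: "nat \<Rightarrow> 'v::complex_vector"
  assumes "finite E" "card E \<le> n" "\<And>i. i \<le> n \<Longrightarrow> v i \<in> cspan E"
  shows "\<exists>c. (\<exists>i\<le>n. c i \<noteq> 0) \<and> (\<Sum>i\<le>n. c i *\<^sub>C v i) = 0"
proof (cases "inj_on v {..n}")
  case True
  have "complex_vector.dependent (v ` {..n})"
  proof (rule ccontr)
    assume "complex_vector.independent (v ` {..n})"
    then have "card (v ` {..n}) \<le> card E"
      using complex_vector.independent_span_bound[OF assms(1), of "v ` {..n}"] assms(3) by auto
    then show False using assms(2) True by (simp add: card_image)
  qed
  then obtain u where u: "\<exists>y\<in>v ` {..n}. u y \<noteq> 0" "(\<Sum>y\<in>v ` {..n}. u y *\<^sub>C y) = 0"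
    using complex_vector.dependent_finite[of "v ` {..n}"] by auto
  then show ?thesis
    using True by (intro exI[of _ "u \<circ> v"]) (auto simp: sum.reindex)
next
  case False
  then obtain i j where ij: "i \<le> n" "j \<le> n" "i \<noteq> j" "v i = v j" by (auto simp: inj_on_def)
  define c :: "nat \<Rightarrow> complex" where "c l = (if l = i then 1 else if l = j then - 1 else 0)" for l
  have "(\<Sum>l\<le>n. c l *\<^sub>C v l) = (\<Sum>l\<in>{i,j}. c l *\<^sub>C v l)"
    using ij by (intro sum.mono_neutral_right) (auto simp: c_def)
  also have "\<dots> = 0" using ij by (simp add: c_def scaleC_one)
  finally show ?thesis using ij by (intro exI[of _ c]) (auto simp: c_def)
qed

text \<open>
  \<open>M\<close> restricts to a linear map from the subspace \<open>W\<close> to itself; outside \<open>W\<close> it is arbitrary.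
\<close>

definition linear_endo_on :: "'v::complex_vector set \<Rightarrow> ('v \<Rightarrow> 'v) \<Rightarrow> bool"
  where "linear_endo_on W M \<longleftrightarrow> complex_vector.subspace W \<and> (\<forall>a\<in>W. M a \<in> W) \<and>
    (\<forall>a\<in>W. \<forall>b\<in>W. M (a + b) = M a + M b) \<and> (\<forall>c. \<forall>a\<in>W. M (c *\<^sub>C a) = c *\<^sub>C M a)"

lemma linear_endo_on_zero: "linear_endo_on W M \<Longrightarrow> M 0 = 0"
  unfolding linear_endo_on_def
  using complex_vector.subspace_0[of W] by (metis complex_vector.scale_zero_left)

lemma linear_endo_on_sum:
  assumes "linear_endo_on W M" "\<And>i. i \<in> I \<Longrightarrow> f i \<in> W"
  shows "M (\<Sum>i\<in>I. c i *\<^sub>C f i) = (\<Sum>i\<in>I. c i *\<^sub>C M (f i))"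
  using assms(2)
proof (induction I rule: infinite_finite_induct)
  case (insert x F)
  have "(\<Sum>i\<in>F. c i *\<^sub>C f i) \<in> W" "c x *\<^sub>C f x \<in> W"
    using assms(1) insert.prems unfolding linear_endo_on_def
    by (auto intro!: complex_vector.subspace_sum complex_vector.subspace_scale)
  then show ?case using insert assms(1) unfolding linear_endo_on_def by simp
qed (use linear_endo_on_zero[OF assms(1)] in auto)

lemma linear_endo_on_funpow:
  assumes "linear_endo_on W M" "a \<in> W"
  shows "(M ^^ i) a \<in> W"
  using assms by (induction i) (auto simp: linear_endo_on_def)

text \<open>
  A nonzero vector annihilated by a nonzero polynomial in \<open>M\<close> produces an eigenvector: split
  off linear factors of the polynomial one by one.
\<close>

lemma eigenvector_of_annihilating_poly:
  fixes M :: "'v::complex_vector \<Rightarrow> 'v"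
  assumes M: "linear_endo_on W M" and v: "v \<in> W" "v \<noteq> 0"
  shows "q \<noteq> 0 \<Longrightarrow> degree q < N \<Longrightarrow> (\<Sum>i<N. coeff q i *\<^sub>C (M ^^ i) v) = 0 \<Longrightarrow>
    \<exists>u\<in>W. \<exists>z. u \<noteq> 0 \<and> M u = z *\<^sub>C u"
proof (induction N arbitrary: q)
  case (Suc N)
  show ?case
  proof (cases "degree q = 0")
    case True
    then have "(\<Sum>i<Suc N. coeff q i *\<^sub>C (M ^^ i) v) = (\<Sum>i\<in>{0}. coeff q i *\<^sub>C (M ^^ i) v)"
      by (intro sum.mono_neutral_right) (auto simp: coeff_eq_0)
    then have "coeff q 0 *\<^sub>C v = 0" using Suc.prems by simp
    moreover have "coeff q 0 \<noteq> 0" using True Suc.prems(1) by (metis leading_coeff_0_iff)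
    ultimately show ?thesis using v by simp
  next
    case False
    then have "\<exists>r. poly q r = 0"
      by (intro fundamental_theorem_of_algebra_alt) auto
    then obtain r s where q: "q = [:- r, 1:] * s" by (metis dvdE poly_eq_0_iff_dvd)
    then have s0: "s \<noteq> 0" using Suc.prems(1) by auto
    have deg: "degree s < N"
      using Suc.prems(2) s0 unfolding q by (subst (asm) degree_mult_eq) auto
    then have sN: "coeff s N = 0" by (simp add: coeff_eq_0)
    define w where "w = (\<Sum>i<N. coeff s i *\<^sub>C (M ^^ i) v)"
    have wW: "w \<in> W"
      unfolding w_def using M linear_endo_on_funpow[OF M v(1)]
      by (auto simp: linear_endo_on_def
          intro!: complex_vector.subspace_sum complex_vector.subspace_scale)
    have Mw: "M w = (\<Sum>i<N. coeff s i *\<^sub>C (M ^^ Suc i) v)"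
      unfolding w_def using linear_endo_on_sum[OF M, of "{..<N}" "\<lambda>i. (M ^^ i) v"]
        linear_endo_on_funpow[OF M v(1)] by simp
    have w2: "w = (\<Sum>i<Suc N. coeff s i *\<^sub>C (M ^^ i) v)" unfolding w_def by (simp add: sN)
    have cq: "coeff q i = (if i = 0 then 0 else coeff s (i - 1)) - r * coeff s i" for i
      unfolding q by (cases i) (auto simp: mult_pCons_left)
    have "(\<Sum>i<Suc N. coeff q i *\<^sub>C (M ^^ i) v) =
        (\<Sum>i<Suc N. (if i = 0 then 0 else coeff s (i - 1)) *\<^sub>C (M ^^ i) v) - r *\<^sub>C w"
      unfolding cq w2 complex_vector.scale_sum_right
      by (simp only: complex_vector.scale_left_diff_distrib sum_subtractf scaleC_scaleC)
    also have "(\<Sum>i<Suc N. (if i = 0 then 0 else coeff s (i - 1)) *\<^sub>C (M ^^ i) v) = M w"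
      unfolding Mw sum.lessThan_Suc_shift by simp
    finally have "M w = r *\<^sub>C w" using Suc.prems(3) by simp
    then show ?thesis
      using wW Suc.IH[OF s0 deg] by (cases "w = 0") (auto simp: w_def)
  qed
qed simp

lemma eigenvector_exists:
  fixes M :: "'v::complex_vector \<Rightarrow> 'v"
  assumes M: "linear_endo_on W M" and "v \<in> W" "v \<noteq> 0" "finite E" "W \<subseteq> cspan E"
  shows "\<exists>u\<in>W. \<exists>z. u \<noteq> 0 \<and> M u = z *\<^sub>C u"
proof -
  have "\<And>i. (M ^^ i) v \<in> cspan E" using linear_endo_on_funpow[OF M] assms by blast
  then obtain c where c: "\<exists>i\<le>card E. c i \<noteq> 0" "(\<Sum>i\<le>card E. c i *\<^sub>C (M ^^ i) v) = 0"
    using linear_relation_of_large_family[OF assms(4) order_refl, of "\<lambda>i. (M ^^ i) v"] by auto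
  define q where "q = (\<Sum>i\<le>card E. monom (c i) i)"
  have cq: "coeff q i = (if i \<le> card E then c i else 0)" for i
    unfolding q_def by (simp add: coeff_sum)
  have "q \<noteq> 0" using c(1) cq by (metis coeff_0)
  moreover have "degree q < Suc (card E)" by (simp add: degree_le cq less_Suc_eq_le)
  moreover have "(\<Sum>i<Suc (card E). coeff q i *\<^sub>C (M ^^ i) v) = 0"
    using c(2) by (simp add: cq lessThan_Suc_atMost)
  ultimately show ?thesis by (rule eigenvector_of_annihilating_poly[OF assms(1-3)])
qed


section \<open>Hermitian forms\<close>

text \<open>Sesquilinear forms are linear in the first argument, as is \<open>cinner\<close>.\<close>

locale sesquilinear =
  fixes s :: "'v::complex_vector \<Rightarrow> 'v \<Rightarrow> complex"
  assumes add_left: "s (x + y) z = s x z + s y z"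
    and scale_left: "s (c *\<^sub>C x) y = c * s x y"
    and add_right: "s x (y + z) = s x y + s x z"
    and scale_right: "s x (c *\<^sub>C y) = cnj c * s x y"
begin

lemma zero_left [simp]: "s 0 y = 0"
  using scale_left[of 0 0 y] by simp

lemma zero_right [simp]: "s x 0 = 0"
  using scale_right[of x 0 0] by simp

lemma diff_left: "s (x - y) z = s x z - s y z"
  using add_left[of "x - y" y z] by simp

lemma diff_right: "s x (y - z) = s x y - s x z"
  using add_right[of x "y - z" z] by simp

lemma minus_left: "s (- x) y = - s x y"
  using diff_left[of 0 x y] by simp

lemma minus_right: "s x (- y) = - s x y"
  using diff_right[of x 0 y] by simp

lemma sum_left: "s (\<Sum>i\<in>I. f i) y = (\<Sum>i\<in>I. s (f i) y)"
  by (induction I rule: infinite_finite_induct) (auto simp: add_left)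

lemma sum_right: "s y (\<Sum>i\<in>I. f i) = (\<Sum>i\<in>I. s y (f i))"
  by (induction I rule: infinite_finite_induct) (auto simp: add_right)

lemma orthonormal_coeff:
  fixes m :: nat
  assumes "\<And>i j. i < m \<Longrightarrow> j < m \<Longrightarrow> s (g i) (g j) = (if i = j then 1 else 0)" "j < m"
  shows "s (\<Sum>i<m. c i *\<^sub>C g i) (g j) = c j"
proof -
  have "s (\<Sum>i<m. c i *\<^sub>C g i) (g j) = (\<Sum>i<m. if i = j then c i else 0)"
    unfolding sum_left scale_left using assms by (intro sum.cong) auto
  then show ?thesis using assms(2) by simp
qed

lemmas expand = add_left add_right scale_left scale_right diff_left diff_right minus_left minus_right

end

locale hermitian_form = sesquilinear +
  assumes commute: "s x y = cnj (s y x)"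
begin

lemma self_real: "Im (s x x) = 0"
  using commute[of x x] by (simp add: complex_eq_iff)

lemma self_of_real: "s x x = of_real (Re (s x x))"
  by (simp add: complex_eq_iff self_real)

text \<open>Cauchy-Schwarz in its degenerate case: an isotropic vector of a positive form is in its
  kernel.\<close>

lemma isotropic_imp_kernel:
  assumes W: "complex_vector.subspace W" and pos: "\<And>a. a \<in> W \<Longrightarrow> 0 \<le> Re (s a a)"
    and "e \<in> W" "Re (s e e) = 0" "a \<in> W"
  shows "s a e = 0"
proof (rule ccontr)
  assume ne: "s a e \<noteq> 0"
  define w where "w = s a e"
  have see: "s e e = 0" using assms(4) self_real by (simp add: complex_eq_iff)
  have sea: "s e a = cnj w" unfolding w_def by (rule commute)
  define t where "t = (Re (s a a) + 1) / (cmod w)\<^sup>2"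
  define b where "b = a - (of_real t * w) *\<^sub>C e"
  have "b \<in> W" unfolding b_def using assms
    by (intro complex_vector.subspace_diff complex_vector.subspace_scale) auto
  have "s b b = s a a - of_real (2 * t) * (w * cnj w)"
    unfolding b_def by (simp add: expand see sea flip: w_def)
  also have "w * cnj w = of_real ((cmod w)\<^sup>2)" by (simp only: complex_norm_square)
  finally have "Re (s b b) = Re (s a a) - 2 * t * (cmod w)\<^sup>2" by simp
  also have "\<dots> = Re (s a a) - 2 * (Re (s a a) + 1)"
    using ne by (simp add: t_def w_def)
  finally show False using pos[OF \<open>b \<in> W\<close>] pos[OF assms(5)] by (simp add: algebra_simps)
qed

end

text \<open>Gram-Schmidt for a positive semidefinite form; vectors of length zero are discarded.\<close>

lemma (in hermitian_form) gram_schmidt: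
  assumes "finite E" "\<forall>a\<in>cspan E. 0 \<le> Re (s a a)"
  shows "\<exists>(m::nat) g. (\<forall>i<m. g i \<in> cspan E) \<and> (\<forall>i<m. \<forall>j<m. s (g i) (g j) = (if i = j then 1 else 0)) \<and>
    (\<forall>a\<in>cspan E. \<forall>b\<in>cspan E. s a b = (\<Sum>i<m. s a (g i) * cnj (s b (g i))))"
  using assms
proof (induction E rule: finite_induct)
  case empty
  then show ?case by (intro exI[of _ 0] exI[of _ "\<lambda>_. 0"]) auto
next
  case (insert e E)
  have sub: "cspan E \<subseteq> cspan (insert e E)" by (intro complex_vector.span_mono) auto
  have "\<exists>(m::nat) g. (\<forall>i<m. g i \<in> cspan E) \<and> (\<forall>i<m. \<forall>j<m. s (g i) (g j) = (if i = j then 1 else 0)) \<and>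
      (\<forall>a\<in>cspan E. \<forall>b\<in>cspan E. s a b = (\<Sum>i<m. s a (g i) * cnj (s b (g i))))"
    using insert.prems sub by (intro insert.IH) blast
  then obtain m :: nat and g where mg: "(\<forall>i<m. g i \<in> cspan E) \<and>
      (\<forall>i<m. \<forall>j<m. s (g i) (g j) = (if i = j then 1 else 0)) \<and>
      (\<forall>a\<in>cspan E. \<forall>b\<in>cspan E. s a b = (\<Sum>i<m. s a (g i) * cnj (s b (g i))))"
    by (elim exE)
  then have g: "\<And>i. i < m \<Longrightarrow> g i \<in> cspan E"
    and on: "\<And>i j. i < m \<Longrightarrow> j < m \<Longrightarrow> s (g i) (g j) = (if i = j then 1 else 0)"
    and dec: "\<And>a b. a \<in> cspan E \<Longrightarrow> b \<in> cspan E \<Longrightarrow> s a b = (\<Sum>i<m. s a (g i) * cnj (s b (g i)))"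
    by blast+
  define f where "f = e - (\<Sum>i<m. s e (g i) *\<^sub>C g i)"
  have pE: "(\<Sum>i<m. s e (g i) *\<^sub>C g i) \<in> cspan E"
    using g by (intro complex_vector.span_sum complex_vector.span_scale) auto
  have f_in: "f \<in> cspan (insert e E)"
    unfolding f_def using pE sub complex_vector.span_base[of e "insert e E"]
    by (intro complex_vector.span_diff) auto
  have fg: "s f (g j) = 0" if "j < m" for j
    using that by (simp add: f_def diff_left orthonormal_coeff[of m g, OF on])
  have fE: "s f b = 0" if b: "b \<in> cspan E" for b
  proof -
    define b' where "b' = b - (\<Sum>i<m. s b (g i) *\<^sub>C g i)"
    have b': "b' \<in> cspan E"
      unfolding b'_def using b g
      by (intro complex_vector.span_diff complex_vector.span_sum complex_vector.span_scale) auto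
    have "s b' (g j) = 0" if "j < m" for j
      using that by (simp add: b'_def diff_left orthonormal_coeff[of m g, OF on])
    then have "Re (s b' b') = 0" using dec[OF b' b'] by simp
    then have "s e b' = 0"
      using isotropic_imp_kernel[where e = b' and a = e, OF complex_vector.subspace_span insert.prems[rule_format]] b' sub
        complex_vector.span_base[of e "insert e E"] by auto
    then have "s e b = (\<Sum>i<m. cnj (s b (g i)) * s e (g i))"
      by (simp add: b'_def diff_right sum_right scale_right)
    moreover have "s (\<Sum>i<m. s e (g i) *\<^sub>C g i) b = (\<Sum>i<m. s e (g i) * cnj (s b (g i)))"
      unfolding sum_left scale_left by (intro sum.cong refl) (simp add: commute[of _ b])
    ultimately show ?thesis by (simp add: f_def diff_left mult.commute)
  qed
  have Ef: "s b f = 0" if "b \<in> cspan E" for b using fE[OF that] commute[of b f] by simp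
  have split: "\<exists>c a1. a1 \<in> cspan E \<and> a = c *\<^sub>C f + a1" if "a \<in> cspan (insert e E)" for a
  proof -
    obtain c where c: "a - c *\<^sub>C e \<in> cspan E"
      using \<open>a \<in> cspan (insert e E)\<close> complex_vector.span_breakdown_eq by blast
    have "a = c *\<^sub>C f + ((a - c *\<^sub>C e) + c *\<^sub>C (\<Sum>i<m. s e (g i) *\<^sub>C g i))"
      by (simp add: f_def complex_vector.scale_right_diff_distrib)
    moreover have "(a - c *\<^sub>C e) + c *\<^sub>C (\<Sum>i<m. s e (g i) *\<^sub>C g i) \<in> cspan E"
      using c pE by (intro complex_vector.span_add complex_vector.span_scale)
    ultimately show ?thesis by blast
  qed
  show ?case
  proof (cases "Re (s f f) = 0")
    case True
    then have ff: "s f f = 0" using self_of_real[of f] by simp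
    have dec': "s a b = (\<Sum>i<m. s a (g i) * cnj (s b (g i)))"
      if ab_in: "a \<in> cspan (insert e E)" "b \<in> cspan (insert e E)" for a b
    proof -
      obtain c d a1 b1 where ab: "a1 \<in> cspan E" "a = c *\<^sub>C f + a1" "b1 \<in> cspan E" "b = d *\<^sub>C f + b1"
        using split[OF ab_in(1)] split[OF ab_in(2)] by blast
      then show ?thesis using dec[of a1 b1] by (simp add: expand ff fE Ef fg)
    qed
    show ?thesis
    proof (intro exI[of _ m] exI[of _ g] conjI allI impI ballI)
      show "g i \<in> cspan (insert e E)" if "i < m" for i using g[OF that] sub by blast
    qed (rule on dec'; assumption)+
  next
    case False
    define n where "n = sqrt (Re (s f f))"
    have "0 \<le> Re (s f f)" using insert.prems f_in by blast
    then have n: "n \<noteq> 0" and ff: "s f f = of_real n * of_real n"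
      using False self_of_real[of f] by (auto simp: n_def simp flip: of_real_mult)
    define g' where "g' i = (if i < m then g i else (1 / of_real n) *\<^sub>C f)" for i
    have gf: "s (g j) f = 0" if "j < m" for j using fg[OF that] commute[of "g j" f] by simp
    have dec': "s a b = (\<Sum>i<Suc m. s a (g' i) * cnj (s b (g' i)))"
      if ab_in: "a \<in> cspan (insert e E)" "b \<in> cspan (insert e E)" for a b
    proof -
      obtain c d a1 b1 where ab: "a1 \<in> cspan E" "a = c *\<^sub>C f + a1" "b1 \<in> cspan E" "b = d *\<^sub>C f + b1"
        using split[OF ab_in(1)] split[OF ab_in(2)] by blast
      have "(\<Sum>i<m. s a (g' i) * cnj (s b (g' i))) = s a1 b1"
        unfolding dec[OF ab(1,3)] by (intro sum.cong refl) (simp add: ab(2,4) g'_def expand fg)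
      moreover have "s a (g' m) * cnj (s b (g' m)) = c * cnj d * s f f"
        using n by (simp add: g'_def ab expand Ef fE ff)
      moreover have "s a b = c * cnj d * s f f + s a1 b1"
        using ab(1,3) by (simp add: ab(2,4) expand Ef fE algebra_simps)
      ultimately show ?thesis by simp
    qed
    have on': "s (g' i) (g' j) = (if i = j then 1 else 0)" if "i < Suc m" "j < Suc m" for i j
      using that n by (auto simp: g'_def on fg gf expand ff)
    have g'_in: "g' i \<in> cspan (insert e E)" for i
      using g sub f_in complex_vector.span_scale[OF f_in] by (auto simp: g'_def)
    show ?thesis
      by (intro exI[of _ "Suc m"] exI[of _ g'] conjI allI impI ballI; rule g'_in on' dec'; assumption)
  qed
qed

lemma (in hermitian_form) orthonormal_expansion:
  fixes m :: nat
  assumes V: "complex_vector.subspace V" and g: "\<And>i. i < m \<Longrightarrow> g i \<in> V"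
    and dec: "\<And>a b. a \<in> V \<Longrightarrow> b \<in> V \<Longrightarrow> s a b = (\<Sum>i<m. s a (g i) * cnj (s b (g i)))"
    and on: "\<And>i j. i < m \<Longrightarrow> j < m \<Longrightarrow> s (g i) (g j) = (if i = j then 1 else 0)"
    and pd: "\<And>a. a \<in> V \<Longrightarrow> Re (s a a) = 0 \<Longrightarrow> a = 0" and "a \<in> V"
  shows "a = (\<Sum>i<m. s a (g i) *\<^sub>C g i)"
proof -
  define b where "b = a - (\<Sum>i<m. s a (g i) *\<^sub>C g i)"
  have bV: "b \<in> V" unfolding b_def using V g \<open>a \<in> V\<close>
    by (intro complex_vector.subspace_diff complex_vector.subspace_sum
        complex_vector.subspace_scale) auto
  have "s b (g j) = 0" if "j < m" for j
    using that by (simp add: b_def diff_left orthonormal_coeff[of m g, OF on])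
  then have "Re (s b b) = 0" using dec[OF bV bV] by simp
  then show ?thesis using pd[OF bV] by (simp add: b_def)
qed

lemma (in hermitian_form) unitary_eigenbasis:
  assumes V: "V = cspan E" "finite E" and M: "linear_endo_on V M"
    and pos: "\<forall>a\<in>V. a \<noteq> 0 \<longrightarrow> 0 < Re (s a a)"
    and isometry: "\<forall>a\<in>V. \<forall>b\<in>V. s (M a) (M b) = s a b"
  shows "\<exists>(N::nat) u z. (\<forall>l<N. u l \<in> V \<and> s (u l) (u l) = 1 \<and> M (u l) = z l *\<^sub>C u l \<and> cmod (z l) = 1) \<and>
    (\<forall>a\<in>V. a = (\<Sum>l<N. s a (u l) *\<^sub>C u l))"
proof -
  note pd = pos[rule_format] and iso = isometry[rule_format]
  define fam where "fam N u z \<longleftrightarrow> (\<forall>l<N. u l \<in> V \<and> M (u l) = z l *\<^sub>C u l \<and> cmod (z l) = 1) \<and>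
    (\<forall>i<N. \<forall>j<N. s (u i) (u j) = (if i = j then 1 else 0))" for N :: nat and u and z :: "nat \<Rightarrow> complex"
  have sub: "complex_vector.subspace V" unfolding V by (rule complex_vector.subspace_span)
  have bound: "N \<le> card E" if f: "fam N u z" for N u z
  proof (rule ccontr)
    assume "\<not> N \<le> card E"
    then obtain n where n: "N = Suc n" "card E \<le> n" by (cases N) auto
    have "\<And>i. i \<le> n \<Longrightarrow> u i \<in> cspan E" using f V n by (auto simp: fam_def)
    from linear_relation_of_large_family[OF V(2) n(2), of u, OF this]
    obtain c j where c: "(\<Sum>i\<le>n. c i *\<^sub>C u i) = 0" "j \<le> n" "c j \<noteq> 0" by auto
    have "s (\<Sum>i\<le>n. c i *\<^sub>C u i) (u j) = (\<Sum>i\<le>n. if i = j then c i else 0)"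
      unfolding sum_left scale_left using f c(2) n by (intro sum.cong refl) (auto simp: fam_def)
    also have "\<dots> = c j" using c(2) by (simp add: sum.delta)
    finally have "s (\<Sum>i\<le>n. c i *\<^sub>C u i) (u j) = c j" .
    then show False using c by simp
  qed
  \<comment> \<open>Take a maximal orthonormal family of eigenvectors; its orthogonal complement is invariant.\<close>
  define N where "N = (GREATEST N. \<exists>u z. fam N u z)"
  have ex: "\<exists>u z. fam 0 u z" by (simp add: fam_def)
  have "\<exists>u z. fam N u z"
    unfolding N_def by (rule GreatestI_nat[of _ 0 "card E"]) (use ex bound in auto)
  then obtain u z where f: "fam N u z" by blast
  have max: "\<not> fam (Suc N) u' z'" for u' z'
    using Greatest_le_nat[of "\<lambda>N. \<exists>u z. fam N u z" "Suc N" "card E"] bound unfolding N_def[symmetric]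
    by fastforce
  define W where "W = {a \<in> V. \<forall>l<N. s a (u l) = 0}"
  have Wsub: "complex_vector.subspace W"
    using sub unfolding complex_vector.subspace_def W_def by (auto simp: expand)
  have "M a \<in> W" if "a \<in> W" for a
  proof -
    have "s (M a) (u l) = 0" if l: "l < N" for l
    proof -
      have u: "u l \<in> V" "M (u l) = z l *\<^sub>C u l" "cmod (z l) = 1" using f l by (auto simp: fam_def)
      have "cnj (z l) * s (M a) (u l) = s (M a) (M (u l))" by (simp add: u scale_right)
      also have "\<dots> = 0" using iso[of a "u l"] u \<open>a \<in> W\<close> l by (simp add: W_def)
      finally show ?thesis using u(3) by auto
    qed
    then show ?thesis using \<open>a \<in> W\<close> M by (auto simp: W_def linear_endo_on_def)
  qed
  then have MW: "linear_endo_on W M"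
    using M Wsub unfolding linear_endo_on_def by (auto simp: W_def)
  have W0: "a = 0" if a: "a \<in> W" for a
  proof (rule ccontr)
    assume "a \<noteq> 0"
    then obtain e y where e: "e \<in> W" "e \<noteq> 0" "M e = y *\<^sub>C e"
      using eigenvector_exists[OF MW a _ V(2)] V by (auto simp: W_def)
    have eV: "e \<in> V" using e by (simp add: W_def)
    define n where "n = sqrt (Re (s e e))"
    have n: "n > 0" "s e e = of_real n * of_real n"
      using pd[OF eV e(2)] self_of_real[of e] by (auto simp: n_def simp flip: of_real_mult)
    have "y * cnj y * s e e = s e e"
      using iso[OF eV eV] by (simp only: e(3) scale_left scale_right mult.assoc mult.left_commute)
    then have "y * cnj y = 1" using n by simp
    then have "(cmod y)\<^sup>2 = 1" by (metis complex_norm_square of_real_eq_1_iff)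
    then have y: "cmod y = 1" by (simp add: abs_square_eq_1)
    have eu: "s e (u l) = 0" "s (u l) e = 0" if "l < N" for l
      using e(1) that commute[of "u l" e] by (auto simp: W_def)
    define w where "w = (1 / of_real n) *\<^sub>C e"
    have "w \<in> V" unfolding w_def by (rule complex_vector.subspace_scale[OF sub eV])
    moreover have "M w = y *\<^sub>C w"
      using M eV unfolding linear_endo_on_def w_def by (simp add: e(3) scaleC_scaleC mult.commute)
    moreover have "s w w = 1" "\<forall>l<N. s w (u l) = 0 \<and> s (u l) w = 0"
      using n by (auto simp: w_def expand eu)
    ultimately have "fam (Suc N) (u(N := w)) (z(N := y))"
      using f y unfolding fam_def by (auto simp: less_Suc_eq)
    then show False using max by blast
  qed
  have "a = (\<Sum>l<N. s a (u l) *\<^sub>C u l)" if a: "a \<in> V" for a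
  proof -
    have "a - (\<Sum>l<N. s a (u l) *\<^sub>C u l) \<in> W"
      unfolding W_def using a sub f
      by (auto simp: diff_left orthonormal_coeff[of N u] fam_def
          intro!: complex_vector.subspace_diff complex_vector.subspace_sum
          complex_vector.subspace_scale)
    then show ?thesis using W0 by fastforce
  qed
  then show ?thesis using f by (intro exI[of _ N] exI[of _ u] exI[of _ z]) (auto simp: fam_def)
qed


section \<open>Decomposition of positive definite block Toeplitz forms\<close>

text \<open>
  The half-plane \<open>0 \<le> 1 + 2 * Re (\<nu> * z)\<close> either contains the unit circle or its boundary line
  meets the unit circle.
\<close>

lemma unit_circle_point_on_boundary:
  obtains z0 where "cmod z0 = 1" "0 \<le> 1 + 2 * Re (\<nu> * z0)"
    "1 + 2 * Re (\<nu> * z0) = 0 \<or> (\<forall>z. cmod z = 1 \<longrightarrow> 0 \<le> 1 + 2 * Re (\<nu> * z))"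
proof (cases "2 * cmod \<nu> < 1")
  case True
  have all: "0 \<le> 1 + 2 * Re (\<nu> * z)" if "cmod z = 1" for z
    using abs_Re_le_cmod[of "\<nu> * z"] True that by (simp add: norm_mult)
  show ?thesis using all[of 1] all by (intro that[of 1]) auto
next
  case False
  define \<rho> where "\<rho> = 2 * cmod \<nu>"
  have \<rho>: "\<rho> \<ge> 1" using False by (simp add: \<rho>_def)
  then have n0: "\<nu> \<noteq> 0" by (auto simp: \<rho>_def)
  define w where "w = Complex (- (1 / \<rho>)) (sqrt (1 - (1 / \<rho>)\<^sup>2))"
  have "(1 / \<rho>)\<^sup>2 \<le> 1" using \<rho> by (simp add: power_le_one)
  then have w: "cmod w = 1" by (simp add: w_def cmod_def)
  have "\<nu> * (cnj (sgn \<nu>) * w) = of_real (cmod \<nu>) * w"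
    using n0 by (simp add: sgn_eq complex_cnj_divide complex_norm_square[symmetric] power2_eq_square
        field_simps)
  then have "1 + 2 * Re (\<nu> * (cnj (sgn \<nu>) * w)) = 0"
    unfolding w_def by (simp only: Re_complex_of_real complex.sel times_complex.sel) (use n0 in \<open>simp add: \<rho>_def\<close>)
  then show ?thesis
    using w n0 by (intro that[of "cnj (sgn \<nu>) * w"]) (auto simp: norm_mult norm_sgn)
qed

lemma Re_sum_mult_cnj: "Re (\<Sum>i\<in>I. f i * cnj (f i)) = (\<Sum>i\<in>I. (cmod (f i))\<^sup>2)"
  by (simp add: complex_norm_square[symmetric] del: of_real_power)

lemma sum_mult_cnj_eq_0:
  assumes "finite I" "Re (\<Sum>i\<in>I. f i * cnj (f i)) = 0" "i \<in> I"
  shows "f i = 0"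
  using assms unfolding Re_sum_mult_cnj by (subst (asm) sum_nonneg_eq_0_iff) auto

lemma hermitian_form_sum_mult_cnj:
  assumes "\<And>i a b. i \<in> I \<Longrightarrow> f i (a + b) = f i a + f i b" "\<And>i c a. i \<in> I \<Longrightarrow> f i (c *\<^sub>C a) = c * f i a"
  shows "hermitian_form (\<lambda>a b. \<Sum>i\<in>I. f i a * cnj (f i b))"
  by unfold_locales
    (auto simp: assms sum.distrib[symmetric] sum_distrib_left algebra_simps intro!: sum.cong)

text \<open>
  The form \<open>\<tau>((a, b), (a', b')) = p a a' + p b b' + x b a' + cnj (x b' a)\<close> on \<open>V \<times> V\<close> is the
  one of the block Toeplitz matrix with diagonal block \<open>p\<close> and off-diagonal block \<open>x\<close>.
  Fix a point \<open>z0\<close> of the circle. Projecting \<open>\<tau>\<close>-orthogonally along the vectors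
  \<open>(- z0 b, b)\<close> splits off a form \<open>r\<close> of Toeplitz type with symbol \<open>z0\<close>, and the remainder,
  having rank \<open>dim V\<close>, is given by a positive definite \<open>p'\<close> and \<open>x' b a = p' (M b) a\<close> with
  a \<open>p'\<close>-unitary \<open>M\<close>. An eigenbasis of \<open>M\<close> diagonalises \<open>p'\<close> and \<open>x'\<close> together. With \<open>z0\<close> on
  the boundary of the half-plane, \<open>r\<close> does not contribute to \<open>p a a + 2 * Re (\<nu> * x a a)\<close>,
  so that the eigenvalues of \<open>M\<close> lie in the half-plane.
\<close>

lemma toeplitz_decomposition:
  fixes p x :: "'v::complex_vector \<Rightarrow> 'v \<Rightarrow> complex"
  assumes p: "hermitian_form p" and x: "sesquilinear x" and E: "finite E" and V: "V = cspan E"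
    and pd: "\<And>a b. a \<in> V \<Longrightarrow> b \<in> V \<Longrightarrow> a \<noteq> 0 \<or> b \<noteq> 0 \<Longrightarrow>
      0 < Re (p a a) + Re (p b b) + 2 * Re (x b a)"
    and half: "\<And>a. a \<in> V \<Longrightarrow> 0 \<le> Re (p a a) + 2 * Re (\<nu> * x a a)"
  shows "\<exists>L. (\<forall>(z, \<phi>)\<in>set L. cmod z = 1 \<and> 0 \<le> 1 + 2 * Re (\<nu> * z)) \<and>
    (\<forall>a\<in>V. \<forall>b\<in>V. p a b = (\<Sum>(z, \<phi>)\<leftarrow>L. \<phi> a * cnj (\<phi> b)) \<and>
      x a b = (\<Sum>(z, \<phi>)\<leftarrow>L. z * (\<phi> a * cnj (\<phi> b))))"
proof -
  interpret p: hermitian_form p by (rule p)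
  interpret x: sesquilinear x by (rule x)
  have sub: "complex_vector.subspace V" unfolding V by (rule complex_vector.subspace_span)
  note subs = complex_vector.subspace_add[OF sub] complex_vector.subspace_diff[OF sub]
    complex_vector.subspace_scale[OF sub] complex_vector.subspace_sum[OF sub]
    complex_vector.subspace_neg[OF sub]
  obtain z0 where z0: "cmod z0 = 1" "0 \<le> 1 + 2 * Re (\<nu> * z0)"
    "1 + 2 * Re (\<nu> * z0) = 0 \<or> (\<forall>z. cmod z = 1 \<longrightarrow> 0 \<le> 1 + 2 * Re (\<nu> * z))"
    by (rule unit_circle_point_on_boundary)
  have zz: "z0 * cnj z0 = 1" using complex_norm_square[of z0] z0(1) by simp
  have zz': "z0 * (cnj z0 * t) = t" "cnj z0 * (z0 * t) = t" for t
    using zz by (simp_all add: mult.assoc[symmetric] mult.commute[of "cnj z0"])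
  define \<gamma> where "\<gamma> b c = 2 * p b c - cnj z0 * x b c - z0 * cnj (x c b)" for b c
  interpret \<gamma>: hermitian_form \<gamma>
    by unfold_locales
      (auto simp: \<gamma>_def p.expand x.expand algebra_simps p.commute[symmetric])
  have \<gamma>_pd: "0 < Re (\<gamma> b b)" if "b \<in> V" "b \<noteq> 0" for b
  proof -
    define c where "c = (- z0) *\<^sub>C b"
    have "c \<in> V" unfolding c_def using that subs by blast
    then have "0 < Re (p c c) + Re (p b b) + 2 * Re (x b c)" using pd[of c b] that by blast
    moreover have "p c c = p b b" "x b c = - (cnj z0 * x b b)"
      unfolding c_def p.scale_left p.scale_right x.scale_right by (simp_all add: zz')
    ultimately show ?thesis by (simp add: \<gamma>_def)
  qed
  have \<gamma>_nn: "\<forall>b\<in>cspan E. 0 \<le> Re (\<gamma> b b)"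
  proof
    show "0 \<le> Re (\<gamma> b b)" if "b \<in> cspan E" for b
      using \<gamma>_pd[of b] that V by (cases "b = 0") auto
  qed
  obtain m :: nat and g where g: "\<forall>i<m. g i \<in> cspan E"
      "\<forall>i<m. \<forall>j<m. \<gamma> (g i) (g j) = (if i = j then 1 else 0)"
      "\<forall>a\<in>cspan E. \<forall>b\<in>cspan E. \<gamma> a b = (\<Sum>i<m. \<gamma> a (g i) * cnj (\<gamma> b (g i)))"
    using \<gamma>.gram_schmidt[OF E \<gamma>_nn] by (elim exE conjE)
  have gV: "\<And>i. i < m \<Longrightarrow> g i \<in> V" using g(1) V by blast
  have on: "\<And>i j. i < m \<Longrightarrow> j < m \<Longrightarrow> \<gamma> (g i) (g j) = (if i = j then 1 else 0)" using g(2) by blast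
  have \<gamma>_dec: "\<And>a b. a \<in> V \<Longrightarrow> b \<in> V \<Longrightarrow> \<gamma> a b = (\<Sum>i<m. \<gamma> a (g i) * cnj (\<gamma> b (g i)))"
    using g(3) V by blast
  have exp: "a = (\<Sum>i<m. \<gamma> a (g i) *\<^sub>C g i)" if "a \<in> V" for a
    by (rule \<gamma>.orthonormal_expansion[OF sub gV \<gamma>_dec on _ that]) (use \<gamma>_pd in force)+
  \<comment> \<open>\<open>C a b\<close> is \<open>\<tau>((a, 0), (- z0 b, b))\<close>, \<open>D b i\<close> is \<open>\<tau>((0, b), (- z0 g\<^sub>i, g\<^sub>i))\<close>, and \<open>\<gamma>\<close> is \<open>\<tau>\<close> on the
    vectors \<open>(- z0 b, b)\<close>.\<close>
  define C where "C a b = cnj (x b a) - cnj z0 * p a b" for a b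
  define D where "D b i = z0 * C b (g i) + \<gamma> b (g i)" for b i
  define p' where "p' a b = (\<Sum>i<m. C a (g i) * cnj (C b (g i)))" for a b
  define r where "r a b = p a b - p' a b" for a b
  interpret C: sesquilinear C
    by unfold_locales (auto simp: C_def p.expand x.expand algebra_simps)
  interpret p': hermitian_form p'
    unfolding p'_def by (rule hermitian_form_sum_mult_cnj) (auto simp: C.expand)
  interpret r: hermitian_form r
    by unfold_locales
      (auto simp: r_def p.expand p'.expand algebra_simps p.commute[symmetric] p'.commute[symmetric])
  have CV: "(\<Sum>i<m. C a (g i) * cnj (\<gamma> b (g i))) = C a b" if "b \<in> V" for a b
    using arg_cong[OF exp[OF that], of "C a"] by (simp add: C.sum_right C.scale_right mult.commute)
  have CV': "(\<Sum>i<m. \<gamma> b (g i) * cnj (C a (g i))) = cnj (C a b)" if "b \<in> V" for a b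
    unfolding CV[OF that, symmetric] by (simp add: mult.commute)
  \<comment> \<open>The remainder of \<open>\<tau>\<close> is the Gram form of \<open>(C a + D b)\<^sub>i\<close>, in both diagonal blocks equal to \<open>p'\<close>.\<close>
  have x_eq: "x b a = (\<Sum>i<m. D b i * cnj (C a (g i))) + z0 * r b a" if "b \<in> V" for a b
  proof -
    have "(\<Sum>i<m. D b i * cnj (C a (g i))) = z0 * p' b a + cnj (C a b)"
      unfolding CV'[OF that, symmetric] p'_def D_def
      by (simp add: algebra_simps sum.distrib sum_distrib_left)
    also have "cnj (C a b) = x b a - z0 * p b a" by (simp add: C_def p.commute[symmetric])
    finally show ?thesis by (simp add: r_def algebra_simps)
  qed
  have D_eq: "(\<Sum>i<m. D a i * cnj (D b i)) = p' a b" if "a \<in> V" "b \<in> V" for a b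
  proof -
    have "D a i * cnj (D b i) = C a (g i) * cnj (C b (g i)) + z0 * (C a (g i) * cnj (\<gamma> b (g i)))
        + cnj z0 * (\<gamma> a (g i) * cnj (C b (g i))) + \<gamma> a (g i) * cnj (\<gamma> b (g i))" for i
      by (simp add: D_def algebra_simps zz')
    then have "(\<Sum>i<m. D a i * cnj (D b i)) = p' a b + z0 * C a b + cnj z0 * cnj (C b a) + \<gamma> a b"
      unfolding CV[OF that(2), symmetric] CV'[OF that(1), symmetric] \<gamma>_dec[OF that] p'_def
      by (simp add: sum.distrib sum_distrib_left)
    then show ?thesis
      by (simp add: C_def \<gamma>_def algebra_simps zz' p.commute[symmetric])
  qed
  have r_nn: "0 \<le> Re (r c c)" if c: "c \<in> V" for c
  proof -
    \<comment> \<open>\<open>(- z0 w, w)\<close> is the \<open>\<tau>\<close>-orthogonal projection of \<open>(c, 0)\<close>, so \<open>r c c\<close> is a value of \<open>\<tau>\<close>.\<close>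
    define w where "w = (\<Sum>i<m. C c (g i) *\<^sub>C g i)"
    have w: "w \<in> V" unfolding w_def using gV by (intro subs) auto
    have wg: "\<gamma> w (g i) = C c (g i)" if "i < m" for i
      unfolding w_def by (rule \<gamma>.orthonormal_coeff[OF on that])
    have \<gamma>w: "\<gamma> w w = p' c c" unfolding \<gamma>_dec[OF w w] p'_def by (simp add: wg)
    have Cw: "C c w = p' c c" unfolding CV[OF w, symmetric] p'_def by (simp add: wg)
    have "0 \<le> Re (p (c + z0 *\<^sub>C w) (c + z0 *\<^sub>C w)) + Re (p (- w) (- w)) + 2 * Re (x (- w) (c + z0 *\<^sub>C w))"
      using pd[of "c + z0 *\<^sub>C w" "- w"] c w subs by (cases "c + z0 *\<^sub>C w = 0 \<and> w = 0") (auto intro: less_imp_le)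
    also have "\<dots> = Re (p c c) + Re (\<gamma> w w) - 2 * Re (C c w)"
    proof -
      have "p w c = cnj (p c w)" by (rule p.commute)
      then show ?thesis
        by (simp add: p.expand x.expand \<gamma>_def C_def zz' algebra_simps)
    qed
    finally show ?thesis by (simp add: \<gamma>w Cw r_def)
  qed
  have p'_pd0: "b = 0" if b: "b \<in> V" "\<And>i. i < m \<Longrightarrow> C b (g i) = 0" for b
  proof -
    have "p' b b = 0" by (simp add: p'_def b)
    then have D0: "D b i = 0" if "i < m" for i
      using sum_mult_cnj_eq_0[of "{..<m}" "D b" i] D_eq[OF b(1) b(1)] that by simp
    have "\<gamma> b (g i) = 0" if "i < m" for i using b(2)[OF that] D0[OF that] by (simp add: D_def)
    then show ?thesis using exp[OF b(1)] by simp
  qed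
  have p'_pd: "0 < Re (p' b b)" if b: "b \<in> V" "b \<noteq> 0" for b
  proof (rule ccontr)
    assume "\<not> 0 < Re (p' b b)"
    moreover have "0 \<le> Re (p' b b)" unfolding p'_def Re_sum_mult_cnj by (intro sum_nonneg) auto
    ultimately have "Re (p' b b) = 0" by simp
    then have "C b (g i) = 0" if "i < m" for i
      using sum_mult_cnj_eq_0[of "{..<m}" "\<lambda>i. C b (g i)" i] that by (simp add: p'_def)
    then show False using p'_pd0 b by blast
  qed
  \<comment> \<open>The injective linear map \<open>a \<mapsto> C a g\<^sub>i\<close> from \<open>V\<close> to \<open>\<complex>\<^sup>m\<close> is onto, as \<open>m = dim V\<close>.\<close>
  have surj: "\<exists>a\<in>V. \<forall>i<m. C a (g i) = d i" for d
  proof -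
    define G where "G a = (\<Sum>i<m. C a (g i) *\<^sub>C g i)" for a
    define e where "e = (\<Sum>i<m. d i *\<^sub>C g i)"
    have GV: "G a \<in> cspan (g ` {..<m})" "e \<in> cspan (g ` {..<m})" for a
      unfolding G_def e_def
      by (intro complex_vector.span_sum complex_vector.span_scale complex_vector.span_base; simp)+
    have Gg: "\<gamma> (G a) (g i) = C a (g i)" if "i < m" for a i
      unfolding G_def by (rule \<gamma>.orthonormal_coeff[OF on that])
    have "card (g ` {..<m}) \<le> m" using card_image_le[of "{..<m}" g] by simp
    moreover have "(if i < m then G (g i) else e) \<in> cspan (g ` {..<m})" for i using GV by simp
    ultimately have "\<exists>c. (\<exists>i\<le>m. c i \<noteq> 0) \<and> (\<Sum>i\<le>m. c i *\<^sub>C (if i < m then G (g i) else e)) = 0"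
      by (intro linear_relation_of_large_family[of "g ` {..<m}"]) auto
    then obtain c where c: "\<exists>i\<le>m. c i \<noteq> 0" "(\<Sum>i\<le>m. c i *\<^sub>C (if i < m then G (g i) else e)) = 0"
      by blast
    define w where "w = (\<Sum>i<m. c i *\<^sub>C g i)"
    have w: "w \<in> V" unfolding w_def using gV by (intro subs) auto
    have "(\<Sum>i<m. c i *\<^sub>C G (g i)) = G w"
      unfolding G_def w_def C.sum_left C.scale_left complex_vector.scale_sum_left
        complex_vector.scale_sum_right scaleC_scaleC by (rule sum.swap)
    then have rel: "G w + c m *\<^sub>C e = 0" using c(2) by (simp add: lessThan_Suc_atMost[symmetric])
    have eg: "\<gamma> e (g i) = d i" if "i < m" for i
      unfolding e_def by (rule \<gamma>.orthonormal_coeff[OF on that])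
    have Cw: "C w (g i) + c m * d i = 0" if "i < m" for i
      using arg_cong[OF rel, of "\<lambda>y. \<gamma> y (g i)"] by (simp add: \<gamma>.expand Gg eg that)
    have "c m \<noteq> 0"
    proof
      assume cm: "c m = 0"
      then have "w = 0" using p'_pd0[OF w] Cw by simp
      then have "c i = 0" if "i < m" for i
        using \<gamma>.orthonormal_coeff[OF on that, of c] by (simp flip: w_def)
      then show False using c(1) cm by (metis le_neq_implies_less)
    qed
    then have "C ((- 1 / c m) *\<^sub>C w) (g i) = d i" if "i < m" for i
      using Cw[OF that] unfolding C.scale_left by (simp add: field_simps add_eq_0_iff2)
    then show ?thesis using subs(3)[OF w] by blast
  qed
  have inj: "a = b" if "a \<in> V" "b \<in> V" "\<And>i. i < m \<Longrightarrow> C a (g i) = C b (g i)" for a b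
    using p'_pd0[of "a - b"] that subs by (simp add: C.diff_left)
  define M where "M b = (SOME a. a \<in> V \<and> (\<forall>i<m. C a (g i) = D b i))" for b
  have M: "M b \<in> V" "\<And>i. i < m \<Longrightarrow> C (M b) (g i) = D b i" for b
    using someI_ex[of "\<lambda>a. a \<in> V \<and> (\<forall>i<m. C a (g i) = D b i)"] surj[of "D b"]
    unfolding M_def by blast+
  have lin: "linear_endo_on V M"
    unfolding linear_endo_on_def using sub M subs
    by (auto intro!: inj simp: C.expand D_def \<gamma>.expand algebra_simps)
  have iso: "\<forall>a\<in>V. \<forall>b\<in>V. p' (M a) (M b) = p' a b"
  proof (intro ballI)
    show "p' (M a) (M b) = p' a b" if "a \<in> V" "b \<in> V" for a b
      unfolding D_eq[OF that, symmetric] by (simp add: p'_def M)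
  qed
  have p'_pos: "\<forall>a\<in>V. a \<noteq> 0 \<longrightarrow> 0 < Re (p' a a)" using p'_pd by blast
  have r_pos: "\<forall>a\<in>cspan E. 0 \<le> Re (r a a)" using r_nn V by blast
  obtain N :: nat and u z where uz: "\<forall>l<N. u l \<in> V \<and> p' (u l) (u l) = 1 \<and> M (u l) = z l *\<^sub>C u l \<and> cmod (z l) = 1"
    and ub: "\<forall>a\<in>V. a = (\<Sum>l<N. p' a (u l) *\<^sub>C u l)"
    using p'.unitary_eigenbasis[OF V E lin p'_pos iso] by (elim exE conjE)
  obtain n :: nat and h where h:
      "\<forall>a\<in>cspan E. \<forall>b\<in>cspan E. r a b = (\<Sum>i<n. r a (h i) * cnj (r b (h i)))"
    using r.gram_schmidt[OF E r_pos] by (elim exE conjE)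
  have p'_dec: "p' a b = (\<Sum>l<N. p' a (u l) * cnj (p' b (u l)))" if "a \<in> V" for a b
  proof -
    have "p' a b = p' (\<Sum>l<N. p' a (u l) *\<^sub>C u l) b" using ub that by simp
    then show ?thesis by (simp add: p'.sum_left p'.scale_left p'.commute[symmetric])
  qed
  have x'_dec: "(\<Sum>i<m. D a i * cnj (C b (g i))) = (\<Sum>l<N. z l * (p' a (u l) * cnj (p' b (u l))))"
    if "a \<in> V" for a b
  proof -
    have "(\<Sum>i<m. D a i * cnj (C b (g i))) = p' (M a) b" by (simp add: p'_def M)
    also have "M a = M (\<Sum>l<N. p' a (u l) *\<^sub>C u l)" using ub that by simp
    also have "\<dots> = (\<Sum>l<N. p' a (u l) *\<^sub>C (z l *\<^sub>C u l))"
      using linear_endo_on_sum[OF lin, of "{..<N}" u] uz by simp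
    finally show ?thesis
      by (simp add: p'.sum_left p'.scale_left p'.commute[symmetric] mult.left_commute mult.assoc)
  qed
  have "0 \<le> 1 + 2 * Re (\<nu> * z l)" if l: "l < N" for l
  proof (cases "1 + 2 * Re (\<nu> * z0) = 0")
    case True
    have u: "u l \<in> V" "p' (u l) (u l) = 1" "M (u l) = z l *\<^sub>C u l" using uz l by auto
    have "(\<Sum>i<m. D (u l) i * cnj (C (u l) (g i))) = p' (M (u l)) (u l)" by (simp add: p'_def M)
    also have "\<dots> = z l" by (simp add: u p'.scale_left)
    finally have xu: "x (u l) (u l) = z l + z0 * r (u l) (u l)" using x_eq[OF u(1)] by simp
    have pu: "p (u l) (u l) = 1 + r (u l) (u l)" by (simp add: r_def u)
    have "Re (\<nu> * (z0 * r (u l) (u l))) = Re (\<nu> * z0) * Re (r (u l) (u l))"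
      by (subst r.self_of_real) (simp flip: mult.assoc)
    then have "0 \<le> 1 + 2 * Re (\<nu> * z l) + (1 + 2 * Re (\<nu> * z0)) * Re (r (u l) (u l))"
      using half[OF u(1)] unfolding xu pu by (simp add: algebra_simps)
    then show ?thesis using True by simp
  next
    case False
    then show ?thesis using z0(3) uz l by auto
  qed
  moreover define L where "L = map (\<lambda>i. (z0, \<lambda>a. r a (h i))) [0..<n] @ map (\<lambda>l. (z l, \<lambda>a. p' a (u l))) [0..<N]"
  ultimately have "\<forall>(z, \<phi>)\<in>set L. cmod z = 1 \<and> 0 \<le> 1 + 2 * Re (\<nu> * z)"
    using z0 uz by auto
  moreover have "p a b = (\<Sum>(z, \<phi>)\<leftarrow>L. \<phi> a * cnj (\<phi> b))" if "a \<in> V" "b \<in> V" for a b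
  proof -
    have "p a b = r a b + p' a b" by (simp add: r_def)
    then show ?thesis using h V that p'_dec[OF that(1), of b]
      by (simp add: L_def o_def interv_sum_list_conv_sum_set_nat atLeast0LessThan)
  qed
  moreover have "x a b = (\<Sum>(z, \<phi>)\<leftarrow>L. z * (\<phi> a * cnj (\<phi> b)))" if "a \<in> V" "b \<in> V" for a b
  proof -
    have "r a b = (\<Sum>i<n. r a (h i) * cnj (r b (h i)))" using h V that by blast
    then have "z0 * r a b = (\<Sum>i<n. z0 * (r a (h i) * cnj (r b (h i))))" by (simp only: sum_distrib_left)
    then show ?thesis using x_eq[OF that(1), of b] x'_dec[OF that(1), of b]
      by (simp add: L_def o_def interv_sum_list_conv_sum_set_nat atLeast0LessThan)
  qed
  ultimately show ?thesis by blast
qed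


section \<open>Forms with matrix coefficients\<close>

text \<open>
  Functions on \<open>nat\<close> form a complex vector space containing \<open>\<complex>\<^sup>k\<close> for every \<open>k\<close>, as needed for
  coefficient matrices of arbitrary size.
\<close>

instantiation "fun" :: (type, complex_vector) complex_vector
begin

definition scaleC_fun :: "complex \<Rightarrow> ('a \<Rightarrow> 'b) \<Rightarrow> 'a \<Rightarrow> 'b"
  where "scaleC_fun c f = (\<lambda>i. c *\<^sub>C f i)"

instance
  by standard (simp_all add: scaleC_fun_def fun_eq_iff scaleC_add_right scaleC_add_left
      scaleC_scaleC scaleC_one)

end

text \<open>
  The value at \<open>(x, y)\<close> of the sesquilinear form on \<open>k\<close>-tuples whose \<open>(i, j)\<close> block is \<open>P i j\<close> times
  the form \<open>s\<close>. Tuples are functions on \<open>nat\<close>, of which only the first \<open>k\<close> values matter.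
\<close>

definition block_form ::
    "nat \<Rightarrow> (nat \<Rightarrow> nat \<Rightarrow> complex) \<Rightarrow> ('a \<Rightarrow> 'a \<Rightarrow> complex) \<Rightarrow> (nat \<Rightarrow> 'a) \<Rightarrow> (nat \<Rightarrow> 'a) \<Rightarrow> complex"
  where "block_form k P s x y = (\<Sum>i<k. \<Sum>j<k. P i j * s (x j) (y i))"

lemma block_form_add_coeff:
  "block_form k (\<lambda>i j. P i j + Q i j) s x y = block_form k P s x y + block_form k Q s x y"
  by (simp add: block_form_def sum.distrib algebra_simps)

lemma block_form_scale_coeff:
  "block_form k (\<lambda>i j. c * P i j) s x y = c * block_form k P s x y"
  by (simp add: block_form_def sum_distrib_left algebra_simps)

lemma block_form_add_form:
  "block_form k P (\<lambda>u v. s u v + t u v) x y = block_form k P s x y + block_form k P t x y"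
  by (simp add: block_form_def sum.distrib algebra_simps)

lemma block_form_scale_form:
  "block_form k P (\<lambda>u v. c * s u v) x y = c * block_form k P s x y"
  by (simp add: block_form_def sum_distrib_left algebra_simps)

lemma block_form_diff_form:
  "block_form k P (\<lambda>u v. s u v - t u v) x y = block_form k P s x y - block_form k P t x y"
  by (simp add: block_form_def sum_subtractf algebra_simps)

lemma block_form_adjoint_coeff:
  "block_form k (\<lambda>i j. cnj (P j i)) s x y = cnj (block_form k P (\<lambda>u v. cnj (s v u)) y x)"
  unfolding block_form_def cnj_sum by (subst sum.swap) simp

lemma block_form_diagonal:
  "block_form k (\<lambda>i j. if i = j then c else 0) s x y = c * (\<Sum>i<k. s (x i) (y i))"
  unfolding block_form_def sum_distrib_left
  by (intro sum.cong refl) (simp add: if_distrib[of "\<lambda>x. x * _"] cong: if_cong)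

lemma block_form_sum_list_coeff:
  "block_form k (\<lambda>i j. \<Sum>l\<leftarrow>L. Q l i j) s x y = (\<Sum>l\<leftarrow>L. block_form k (Q l) s x y)"
proof (induction L)
  case Nil
  show ?case by (simp add: block_form_def)
next
  case (Cons l L)
  then show ?case by (simp add: block_form_add_coeff)
qed

lemma block_form_cong:
  "(\<And>i j. i < k \<Longrightarrow> j < k \<Longrightarrow> P i j = Q i j) \<Longrightarrow> block_form k P s x y = block_form k Q s x y"
  by (simp add: block_form_def)

lemma sesquilinear_block_form:
  assumes "sesquilinear s"
  shows "sesquilinear (block_form k P s)"
proof -
  interpret sesquilinear s by fact
  show ?thesis
    by unfold_locales
      (simp_all add: block_form_def scaleC_fun_def expand sum.distrib sum_distrib_left algebra_simps)
qed

lemma block_form_rank_one_coeff: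
  assumes "sesquilinear s"
  shows "block_form k (\<lambda>i j. \<phi> j * cnj (\<phi> i)) s x x =
    s (\<Sum>j<k. \<phi> j *\<^sub>C x j) (\<Sum>j<k. \<phi> j *\<^sub>C x j)"
proof -
  interpret sesquilinear s by fact
  show ?thesis
    unfolding block_form_def sum_right sum_left scale_right scale_left sum_distrib_left
    by (intro sum.cong refl) (simp add: algebra_simps)
qed

abbreviation mult_cnj :: "complex \<Rightarrow> complex \<Rightarrow> complex"
  where "mult_cnj u v \<equiv> u * cnj v"

lemma sesquilinear_mult_cnj: "sesquilinear mult_cnj"
  by unfold_locales (simp_all add: scaleC_complex_def algebra_simps)

text \<open>
  Let \<open>E = E\<^sub>1\<^sub>2 \<oplus> [\<nu>]\<close>. The hypothesis \<open>pos\<close> says that \<open>I \<mapsto> n, E \<mapsto> m\<close> is nonnegative on the positive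
  matrices \<open>I + z E + cnj z E*\<close> with \<open>z\<close> unimodular, and \<open>pd\<close>, \<open>half\<close> that
  \<open>P \<otimes> I + X \<otimes> E + X* \<otimes> E*\<close> is positive, its upper block being positive definite.
\<close>

lemma toeplitz_positive:
  fixes n m :: "'h::complex_vector \<Rightarrow> 'h \<Rightarrow> complex"
  assumes n: "sesquilinear n" and m: "sesquilinear m"
    and herm: "\<And>i j. P i j = cnj (P j i)"
    and pd: "\<And>a b i. i < k \<Longrightarrow> a i \<noteq> 0 \<or> b i \<noteq> 0 \<Longrightarrow>
      0 < Re (block_form k P mult_cnj a a) + Re (block_form k P mult_cnj b b) +
        2 * Re (block_form k X mult_cnj b a)"
    and half: "\<And>a. 0 \<le> Re (block_form k P mult_cnj a a) + 2 * Re (\<nu> * block_form k X mult_cnj a a)"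
    and pos: "\<And>z y. cmod z = 1 \<Longrightarrow> 0 \<le> 1 + 2 * Re (\<nu> * z) \<Longrightarrow> 0 \<le> Re (n y y) + 2 * Re (z * m y y)"
  shows "0 \<le> Re (block_form k P n x x) + 2 * Re (block_form k X m x x)"
proof -
  define e :: "nat \<Rightarrow> nat \<Rightarrow> complex" where "e i = (\<lambda>j. if j = i then 1 else 0)" for i
  define E where "E = e ` {..<k}"
  have herm_p: "hermitian_form (block_form k P mult_cnj)"
  proof -
    interpret sesquilinear "block_form k P mult_cnj"
      by (rule sesquilinear_block_form[OF sesquilinear_mult_cnj])
    have "P = (\<lambda>i j. cnj (P j i))" using herm by (intro ext)
    then have "block_form k P mult_cnj a b = cnj (block_form k P mult_cnj b a)" for a b
      using block_form_adjoint_coeff[of k P mult_cnj a b] by (simp add: mult.commute)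
    then show ?thesis by unfold_locales
  qed
  have "cspan E \<subseteq> {a. \<forall>i\<ge>k. a i = 0}"
    by (rule complex_vector.span_minimal)
      (auto simp: E_def e_def complex_vector.subspace_def scaleC_fun_def scaleC_complex_def)
  then have supp: "\<exists>i<k. a i \<noteq> 0" if "a \<in> cspan E" "a \<noteq> 0" for a
    using that by (auto simp: fun_eq_iff not_le[symmetric])
  have "\<exists>L. (\<forall>(z, \<phi>)\<in>set L. cmod z = 1 \<and> 0 \<le> 1 + 2 * Re (\<nu> * z)) \<and>
    (\<forall>a\<in>cspan E. \<forall>b\<in>cspan E.
      block_form k P mult_cnj a b = (\<Sum>(z, \<phi>)\<leftarrow>L. \<phi> a * cnj (\<phi> b)) \<and>
      block_form k X mult_cnj a b = (\<Sum>(z, \<phi>)\<leftarrow>L. z * (\<phi> a * cnj (\<phi> b))))"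
  proof (rule toeplitz_decomposition[OF herm_p sesquilinear_block_form[OF sesquilinear_mult_cnj] _ refl])
    show "finite E" by (simp add: E_def)
    fix a b assume "a \<in> cspan E" "b \<in> cspan E" "a \<noteq> 0 \<or> b \<noteq> 0"
    then obtain i where "i < k" "a i \<noteq> 0 \<or> b i \<noteq> 0" using supp by blast
    then show "0 < Re (block_form k P mult_cnj a a) + Re (block_form k P mult_cnj b b) +
        2 * Re (block_form k X mult_cnj b a)" by (rule pd)
  qed (rule half)
  then obtain L where Lz: "\<forall>(z, \<phi>)\<in>set L. cmod z = 1 \<and> 0 \<le> 1 + 2 * Re (\<nu> * z)"
    and L: "\<And>a b. a \<in> cspan E \<Longrightarrow> b \<in> cspan E \<Longrightarrow>
      block_form k P mult_cnj a b = (\<Sum>(z, \<phi>)\<leftarrow>L. \<phi> a * cnj (\<phi> b)) \<and>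
      block_form k X mult_cnj a b = (\<Sum>(z, \<phi>)\<leftarrow>L. z * (\<phi> a * cnj (\<phi> b)))" by blast
  have coord: "block_form k Q mult_cnj (e j) (e i) = Q i j" if "i < k" "j < k" for Q i j
  proof -
    have "block_form k Q mult_cnj (e j) (e i) =
        (\<Sum>i'<k. if i' = i then \<Sum>j'<k. if j' = j then Q i j else 0 else 0)"
      unfolding block_form_def e_def
      by (intro sum.cong refl) (auto simp: if_distrib[of "\<lambda>x. _ * x"] cong: if_cong)
    then show ?thesis using that by simp
  qed
  have e: "e i \<in> cspan E" if "i < k" for i
    using that by (auto simp: E_def intro: complex_vector.span_base)
  define y where "y \<phi> = (\<Sum>j<k. \<phi> (e j) *\<^sub>C x j)" for \<phi> :: "(nat \<Rightarrow> complex) \<Rightarrow> complex"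
  have Pij: "P i j = (\<Sum>l\<leftarrow>L. snd l (e j) * cnj (snd l (e i)))"
    and Xij: "X i j = (\<Sum>l\<leftarrow>L. fst l * (snd l (e j) * cnj (snd l (e i))))" if "i < k" "j < k" for i j
    using L[OF e[OF that(2)] e[OF that(1)]] coord[OF that, of P] coord[OF that, of X]
    by (simp_all add: case_prod_unfold)
  have "block_form k P n x x = block_form k (\<lambda>i j. \<Sum>l\<leftarrow>L. snd l (e j) * cnj (snd l (e i))) n x x"
    by (intro block_form_cong Pij)
  also have "\<dots> = (\<Sum>l\<leftarrow>L. n (y (snd l)) (y (snd l)))"
    by (simp add: block_form_sum_list_coeff block_form_rank_one_coeff[OF n] y_def)
  finally have P_eq: "block_form k P n x x = (\<Sum>l\<leftarrow>L. n (y (snd l)) (y (snd l)))" .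
  have "block_form k X m x x = block_form k (\<lambda>i j. \<Sum>l\<leftarrow>L. fst l * (snd l (e j) * cnj (snd l (e i)))) m x x"
    by (intro block_form_cong Xij)
  also have "\<dots> = (\<Sum>l\<leftarrow>L. fst l * m (y (snd l)) (y (snd l)))"
    by (simp add: block_form_sum_list_coeff block_form_scale_coeff block_form_rank_one_coeff[OF m] y_def)
  finally have X_eq: "block_form k X m x x = (\<Sum>l\<leftarrow>L. fst l * m (y (snd l)) (y (snd l)))" .
  have "Re (block_form k P n x x) + 2 * Re (block_form k X m x x) =
      (\<Sum>l\<leftarrow>L. Re (n (y (snd l)) (y (snd l))) + 2 * Re (fst l * m (y (snd l)) (y (snd l))))"
    unfolding P_eq X_eq by (induction L) auto
  moreover have "0 \<le> Re (n (y (snd l)) (y (snd l))) + 2 * Re (fst l * m (y (snd l)) (y (snd l)))"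
    if "l \<in> set L" for l
    using Lz that by (intro pos) (auto simp: case_prod_unfold)
  ultimately show ?thesis by (auto intro!: sum_list_nonneg)
qed


section \<open>Perturbation to a positive definite Toeplitz form\<close>

lemma cmod_add_le_cmod_stretch:
  assumes "0 \<le> s" "0 \<le> \<epsilon>" "cmod v \<le> s * cmod u"
  shows "cmod (of_real s * u + v) \<le> cmod (of_real (s + \<epsilon>) * u + v)"
proof -
  have "- (cmod u * cmod v) \<le> Re (u * cnj v)"
    using abs_Re_le_cmod[of "u * cnj v"] by (simp add: norm_mult)
  moreover have "cmod u * cmod v \<le> s * (cmod u)\<^sup>2"
    using mult_left_mono[OF assms(3), of "cmod u"] by (simp add: power2_eq_square algebra_simps)
  ultimately have "0 \<le> 2 * \<epsilon> * (s * (cmod u)\<^sup>2 + Re (u * cnj v))"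
    using assms(2) by (intro mult_nonneg_nonneg) auto
  then have "0 \<le> \<epsilon>\<^sup>2 * (cmod u)\<^sup>2 + 2 * \<epsilon> * (s * (cmod u)\<^sup>2 + Re (u * cnj v))"
    by (intro add_nonneg_nonneg) auto
  moreover have "(cmod (of_real (s + \<epsilon>) * u + v))\<^sup>2 = (cmod (of_real s * u + v))\<^sup>2 +
      (\<epsilon>\<^sup>2 * (cmod u)\<^sup>2 + 2 * \<epsilon> * (s * (cmod u)\<^sup>2 + Re (u * cnj v)))"
    unfolding cmod_power2 by (simp add: power2_eq_square algebra_simps)
  ultimately have "(cmod (of_real s * u + v))\<^sup>2 \<le> (cmod (of_real (s + \<epsilon>) * u + v))\<^sup>2"
    by linarith
  then show ?thesis by (rule power2_le_imp_le) (rule norm_ge_zero)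
qed

lemma block_form_bound:
  "2 * \<bar>Re (w * block_form k Y mult_cnj b a)\<bar> \<le>
    cmod w * (\<Sum>i<k. \<Sum>j<k. cmod (Y i j)) * ((\<Sum>i<k. (cmod (a i))\<^sup>2) + (\<Sum>i<k. (cmod (b i))\<^sup>2))"
proof -
  let ?S = "(\<Sum>i<k. (cmod (a i))\<^sup>2) + (\<Sum>i<k. (cmod (b i))\<^sup>2)"
  have summand: "2 * cmod (Y i j * mult_cnj (b j) (a i)) \<le> cmod (Y i j) * ?S" if "i < k" "j < k" for i j
  proof -
    have "(cmod (a i))\<^sup>2 \<le> (\<Sum>i<k. (cmod (a i))\<^sup>2)" "(cmod (b j))\<^sup>2 \<le> (\<Sum>i<k. (cmod (b i))\<^sup>2)"
      using that by (auto intro: member_le_sum)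
    moreover have "2 * (cmod (b j) * cmod (a i)) \<le> (cmod (a i))\<^sup>2 + (cmod (b j))\<^sup>2"
      using sum_squares_bound[of "cmod (b j)" "cmod (a i)"] by (simp add: algebra_simps)
    ultimately have "2 * (cmod (b j) * cmod (a i)) \<le> ?S" by linarith
    from mult_left_mono[OF this, of "cmod (Y i j)"] show ?thesis
      by (simp add: norm_mult algebra_simps)
  qed
  have "2 * cmod (block_form k Y mult_cnj b a) \<le> (\<Sum>i<k. \<Sum>j<k. 2 * cmod (Y i j * mult_cnj (b j) (a i)))"
    unfolding block_form_def sum_distrib_left[symmetric]
    by (intro mult_left_mono order_trans[OF norm_sum sum_mono[OF norm_sum]]) auto
  also have "\<dots> \<le> (\<Sum>i<k. \<Sum>j<k. cmod (Y i j) * ?S)" by (intro sum_mono summand) auto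
  also have "\<dots> = (\<Sum>i<k. \<Sum>j<k. cmod (Y i j)) * ?S" by (simp add: sum_distrib_right)
  finally have "cmod w * (2 * cmod (block_form k Y mult_cnj b a)) \<le> cmod w * ((\<Sum>i<k. \<Sum>j<k. cmod (Y i j)) * ?S)"
    by (rule mult_left_mono) simp
  then show ?thesis
    using abs_Re_le_cmod[of "w * block_form k Y mult_cnj b a"] by (simp add: norm_mult mult.assoc)
qed

text \<open>
  The analogue for \<open>A = [[\<alpha>, \<beta>], [\<gamma>, \<alpha>]] \<oplus> [\<mu>]\<close>, without positive definiteness. The hypothesis \<open>pos\<close>
  says that \<open>I \<mapsto> n, A \<mapsto> m\<close> is nonnegative on the positive matrices \<open>a I + b A + cnj b A*\<close>, and
  \<open>upper\<close>, \<open>lower\<close> that \<open>P \<otimes> I + Y \<otimes> A + Y* \<otimes> A*\<close> is positive. Replacing \<open>\<beta>\<close> by a slightly longer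
  \<open>\<beta>'\<close> of the same direction preserves \<open>pos\<close>, because \<open>\<bar>b \<beta> + cnj (b \<gamma>)\<bar>\<close> does not decrease, and
  makes \<open>E\<close> a linear combination of \<open>I\<close>, the new \<open>A\<close> and its adjoint. Adding \<open>\<delta> I\<close> to the given element
  makes it positive definite with respect to the new \<open>A\<close>.
\<close>

lemma equal_diagonal_positive:
  fixes n m :: "'h::complex_vector \<Rightarrow> 'h \<Rightarrow> complex"
  assumes n: "hermitian_form n" and m: "sesquilinear m"
    and \<beta>\<gamma>: "cmod \<gamma> \<le> cmod \<beta>"
    and pos: "\<And>a b y. cmod (b * \<beta> + cnj b * cnj \<gamma>) \<le> a + 2 * Re (b * \<alpha>) \<Longrightarrow>
      0 \<le> a + 2 * Re (b * \<mu>) \<Longrightarrow> 0 \<le> a * Re (n y y) + 2 * Re (b * m y y)"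
    and herm: "\<And>i j. P i j = cnj (P j i)"
    and upper: "\<And>a b. 0 \<le> Re (block_form k P mult_cnj a a) + 2 * Re (\<alpha> * block_form k Y mult_cnj a a) +
      Re (block_form k P mult_cnj b b) + 2 * Re (\<alpha> * block_form k Y mult_cnj b b) +
      2 * Re (\<beta> * block_form k Y mult_cnj b a + \<gamma> * block_form k Y mult_cnj a b)"
    and lower: "\<And>a. 0 \<le> Re (block_form k P mult_cnj a a) + 2 * Re (\<mu> * block_form k Y mult_cnj a a)"
  shows "0 \<le> Re (block_form k P n x x) + 2 * Re (block_form k Y m x x)"
proof -
  interpret n: hermitian_form n by (rule n)
  interpret m: sesquilinear m by (rule m)
  define K where "K = Re (\<Sum>i<k. n (x i) (x i))"
  have main: "0 \<le> Re (block_form k P n x x) + 2 * Re (block_form k Y m x x) + \<delta> * K" if \<delta>: "0 < \<delta>" for \<delta>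
  proof -
    define S where "S = (\<Sum>i<k. \<Sum>j<k. cmod (Y i j))"
    have S: "0 \<le> S" unfolding S_def by (intro sum_nonneg) auto
    \<comment> \<open>By the bound \<open>S\<close> on \<open>Y\<close>, changing \<open>\<beta>\<close> by \<open>\<epsilon>\<close> costs less than the gain from \<open>\<delta> I\<close>.\<close>
    define \<epsilon> where "\<epsilon> = \<delta> / (S + 1)"
    have \<epsilon>: "0 < \<epsilon>" "\<epsilon> * S < \<delta>" using \<delta> S by (simp_all add: \<epsilon>_def field_simps)
    define \<kappa> where "\<kappa> = (if \<beta> = 0 then 1 else sgn \<beta>)"
    have \<kappa>: "cmod \<kappa> = 1" by (simp add: \<kappa>_def norm_sgn)
    have \<beta>_eq: "\<beta> = of_real (cmod \<beta>) * \<kappa>" by (simp add: \<kappa>_def sgn_eq)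
    define \<beta>' where "\<beta>' = of_real (cmod \<beta> + \<epsilon>) * \<kappa>"
    have \<beta>'_eq: "\<beta>' = \<beta> + of_real \<epsilon> * \<kappa>" by (subst \<beta>_eq) (simp add: \<beta>'_def algebra_simps)
    have "cmod \<beta>' = cmod \<beta> + \<epsilon>" using \<epsilon> \<kappa> by (simp add: \<beta>'_def norm_mult del: of_real_add)
    then have "cmod \<gamma> < cmod \<beta>'" using \<beta>\<gamma> \<epsilon> by linarith
    then have "(cmod \<gamma>)\<^sup>2 < (cmod \<beta>')\<^sup>2" by (intro power_strict_mono) auto
    define \<Delta> where "\<Delta> = \<beta>' * cnj \<beta>' - \<gamma> * cnj \<gamma>"
    have "\<Delta> = of_real ((cmod \<beta>')\<^sup>2 - (cmod \<gamma>)\<^sup>2)"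
      by (simp only: \<Delta>_def of_real_diff complex_norm_square)
    then have \<Delta>: "\<Delta> \<noteq> 0"
      using \<open>(cmod \<gamma>)\<^sup>2 < (cmod \<beta>')\<^sup>2\<close> by (simp only: of_real_eq_0_iff)
    have \<Delta>_cnj: "cnj \<Delta> = \<Delta>" by (simp add: \<Delta>_def mult.commute)
    define \<nu> where "\<nu> = (cnj \<beta>' * (\<mu> - \<alpha>) - \<gamma> * cnj (\<mu> - \<alpha>)) / \<Delta>"
    have \<mu>_eq: "\<mu> = \<alpha> + \<beta>' * \<nu> + \<gamma> * cnj \<nu>"
    proof -
      have "\<Delta> * (\<beta>' * \<nu> + \<gamma> * cnj \<nu>) = \<Delta> * (\<mu> - \<alpha>)"
        using \<Delta> by (simp add: \<nu>_def \<Delta>_cnj distrib_left, (simp add: \<Delta>_def algebra_simps)?)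
      then have "\<beta>' * \<nu> + \<gamma> * cnj \<nu> = \<mu> - \<alpha>" using \<Delta> by (metis mult_cancel_left)
      then show ?thesis by (simp add: algebra_simps)
    qed
    define d where "d u v = m u v - \<alpha> * n u v" for u v
    \<comment> \<open>\<open>\<nu>\<close> and \<open>m'\<close> solve \<open>\<mu> = \<alpha> + \<beta>' \<nu> + \<gamma> cnj \<nu>\<close> and \<open>m = \<alpha> n + \<beta>' m' + \<gamma> m'*\<close>.\<close>
    define m' where "m' u v = (cnj \<beta>' * d u v - \<gamma> * cnj (d v u)) / \<Delta>" for u v
    have d_eq: "d u v = \<beta>' * m' u v + \<gamma> * cnj (m' v u)" for u v
    proof -
      have "\<Delta> * (\<beta>' * m' u v + \<gamma> * cnj (m' v u)) = \<Delta> * d u v"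
        using \<Delta> by (simp add: m'_def \<Delta>_cnj distrib_left, (simp add: \<Delta>_def algebra_simps)?)
      then show ?thesis using \<Delta> by (metis mult_cancel_left)
    qed
    have m': "sesquilinear m'"
      by unfold_locales (simp_all add: m'_def d_def n.expand m.expand add_divide_distrib diff_divide_distrib algebra_simps)
    define P' where "P' i j = P i j + (if i = j then of_real \<delta> else 0) + (\<alpha> * Y i j + cnj \<alpha> * cnj (Y j i))" for i j
    define X where "X i j = \<beta>' * Y i j + cnj \<gamma> * cnj (Y j i)" for i j
    have P'_form: "Re (block_form k P' s a a) = Re (block_form k P s a a) + \<delta> * Re (\<Sum>i<k. s (a i) (a i))
        + 2 * Re (\<alpha> * block_form k Y s a a)" if "\<And>u v. s u v = cnj (s v u)" for s :: "'z \<Rightarrow> 'z \<Rightarrow> complex" and a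
      unfolding P'_def block_form_add_coeff block_form_scale_coeff block_form_diagonal
        block_form_adjoint_coeff that[symmetric] by simp
    have mc: "mult_cnj u v = cnj (mult_cnj v u)" for u v by simp
    have X_form: "block_form k X mult_cnj b a = \<beta>' * block_form k Y mult_cnj b a +
        cnj (\<gamma> * block_form k Y mult_cnj a b)" for a b
      unfolding X_def block_form_add_coeff block_form_scale_coeff block_form_adjoint_coeff
        mc[symmetric] by simp
    have sq: "Re (\<Sum>i<k. mult_cnj (a i) (a i)) = (\<Sum>i<k. (cmod (a i))\<^sup>2)" for a
      by (rule Re_sum_mult_cnj)
    have "0 \<le> Re (block_form k P' n x x) + 2 * Re (block_form k X m' x x)"
    proof (rule toeplitz_positive[OF n.sesquilinear_axioms m'])
      show "P' i j = cnj (P' j i)" for i j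
        by (simp add: P'_def herm[symmetric] algebra_simps)
    next
      fix a b :: "nat \<Rightarrow> complex" and i
      assume "i < k" "a i \<noteq> 0 \<or> b i \<noteq> 0"
      define N where "N = (\<Sum>i<k. (cmod (a i))\<^sup>2) + (\<Sum>i<k. (cmod (b i))\<^sup>2)"
      have N: "N > 0"
      proof -
        have "(cmod (a i))\<^sup>2 \<le> (\<Sum>i<k. (cmod (a i))\<^sup>2)" "(cmod (b i))\<^sup>2 \<le> (\<Sum>i<k. (cmod (b i))\<^sup>2)"
          using \<open>i < k\<close> by (auto intro: member_le_sum)
        moreover have "0 < (cmod (a i))\<^sup>2 + (cmod (b i))\<^sup>2"
          using \<open>a i \<noteq> 0 \<or> b i \<noteq> 0\<close> by (auto intro: add_pos_nonneg add_nonneg_pos)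
        ultimately show ?thesis unfolding N_def by linarith
      qed
      have "2 * \<bar>Re (of_real \<epsilon> * \<kappa> * block_form k Y mult_cnj b a)\<bar> \<le> \<epsilon> * S * N"
        using block_form_bound[of "of_real \<epsilon> * \<kappa>" k Y b a] \<epsilon> \<kappa> by (simp add: norm_mult N_def S_def)
      also have "\<dots> < \<delta> * N" using \<epsilon> N by simp
      finally have "0 < \<delta> * N + 2 * Re (of_real \<epsilon> * \<kappa> * block_form k Y mult_cnj b a)" by linarith
      then show "0 < Re (block_form k P' mult_cnj a a) + Re (block_form k P' mult_cnj b b) +
          2 * Re (block_form k X mult_cnj b a)"
        using upper[of a b] unfolding P'_form[OF mc] X_form sq N_def \<beta>'_eq
        by (simp add: algebra_simps)
    next
      fix a :: "nat \<Rightarrow> complex"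
      have "Re (\<nu> * block_form k X mult_cnj a a) = Re ((\<beta>' * \<nu> + \<gamma> * cnj \<nu>) * block_form k Y mult_cnj a a)"
        unfolding X_form by (simp add: algebra_simps)
      moreover have "0 \<le> \<delta> * (\<Sum>i<k. (cmod (a i))\<^sup>2)" using \<delta> by (intro mult_nonneg_nonneg sum_nonneg) auto
      ultimately show "0 \<le> Re (block_form k P' mult_cnj a a) + 2 * Re (\<nu> * block_form k X mult_cnj a a)"
        using lower[of a] unfolding P'_form[OF mc] sq by (subst (asm) \<mu>_eq) (simp add: algebra_simps)
    next
      fix z y assume z: "cmod z = 1" "0 \<le> 1 + 2 * Re (\<nu> * z)"
      \<comment> \<open>The coefficient of the new \<open>A\<close> in \<open>I + z E + cnj z E*\<close>; that of \<open>I\<close> is \<open>1 - 2 Re (b \<alpha>)\<close>.\<close>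
      define b where "b = (cnj \<beta>' * z - cnj \<gamma> * cnj z) / \<Delta>"
      have z_eq: "b * \<beta>' + cnj b * cnj \<gamma> = z"
      proof -
        have "\<Delta> * (b * \<beta>' + cnj b * cnj \<gamma>) = \<Delta> * z"
          using \<Delta> by (simp add: b_def \<Delta>_cnj distrib_left, (simp add: \<Delta>_def algebra_simps)?)
        then show ?thesis using \<Delta> by (metis mult_cancel_left)
      qed
      have dz: "Re (z * ((cnj \<beta>' * t - \<gamma> * cnj t) / \<Delta>)) = Re (b * t)" for t
      proof -
        define q where "q = cnj \<gamma> * cnj z * t / \<Delta>"
        have "z * ((cnj \<beta>' * t - \<gamma> * cnj t) / \<Delta>) = cnj \<beta>' * z * t / \<Delta> - cnj q"
          by (simp add: q_def \<Delta>_cnj diff_divide_distrib algebra_simps)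
        moreover have "b * t = cnj \<beta>' * z * t / \<Delta> - q"
          by (simp add: b_def q_def diff_divide_distrib algebra_simps)
        ultimately show ?thesis by (simp only: minus_complex.sel cnj.sel)
      qed
      have "cmod (cnj b * cnj \<gamma>) \<le> cmod \<beta> * cmod (b * \<kappa>)"
        using mult_left_mono[OF \<beta>\<gamma>, of "cmod b"] \<kappa> by (simp add: norm_mult mult.commute)
      then have "cmod (of_real (cmod \<beta>) * (b * \<kappa>) + cnj b * cnj \<gamma>) \<le>
          cmod (of_real (cmod \<beta> + \<epsilon>) * (b * \<kappa>) + cnj b * cnj \<gamma>)"
        using \<epsilon> by (intro cmod_add_le_cmod_stretch) auto
      also have "of_real (cmod \<beta> + \<epsilon>) * (b * \<kappa>) = b * \<beta>'" by (simp add: \<beta>'_def algebra_simps)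
      also have "of_real (cmod \<beta>) * (b * \<kappa>) = b * \<beta>" by (subst (2) \<beta>_eq) (simp add: algebra_simps)
      finally have "cmod (b * \<beta> + cnj b * cnj \<gamma>) \<le> 1" by (simp add: z_eq z)
      moreover have "Re (b * (\<mu> - \<alpha>)) = Re (\<nu> * z)"
        using dz[of "\<mu> - \<alpha>"] by (simp only: \<nu>_def mult.commute[of z])
      ultimately have "0 \<le> (1 - 2 * Re (b * \<alpha>)) * Re (n y y) + 2 * Re (b * m y y)"
        using z(2) by (intro pos) (simp_all add: algebra_simps)
      moreover have "Re (z * m' y y) = Re (b * m y y) - Re (b * \<alpha>) * Re (n y y)"
      proof -
        have "Re (z * m' y y) = Re (b * d y y)" unfolding m'_def by (rule dz)
        moreover have "Im (n y y) = 0" by (rule n.self_real)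
        ultimately show ?thesis by (simp add: d_def algebra_simps)
      qed
      ultimately show "0 \<le> Re (n y y) + 2 * Re (z * m' y y)" by (simp add: algebra_simps)
    qed
    also have "Re (block_form k X m' x x) = Re (block_form k Y m x x) - Re (\<alpha> * block_form k Y n x x)"
    proof -
      have "block_form k X m' x x = \<beta>' * block_form k Y m' x x + cnj (\<gamma> * block_form k Y (\<lambda>u v. cnj (m' v u)) x x)"
        unfolding X_def block_form_add_coeff block_form_scale_coeff block_form_adjoint_coeff by simp
      then have "Re (block_form k X m' x x) = Re (block_form k Y (\<lambda>u v. \<beta>' * m' u v + \<gamma> * cnj (m' v u)) x x)"
        by (simp add: block_form_add_form block_form_scale_form)
      also have "\<dots> = Re (block_form k Y (\<lambda>u v. m u v - \<alpha> * n u v) x x)"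
        by (simp only: d_eq[symmetric] d_def)
      finally show ?thesis by (simp add: block_form_diff_form block_form_scale_form)
    qed
    finally show ?thesis unfolding P'_form[OF n.commute] K_def by simp
  qed
  show ?thesis
  proof (rule field_le_epsilon)
    fix \<eta> :: real assume \<eta>: "0 < \<eta>"
    have "\<eta> / (\<bar>K\<bar> + 1) * K \<le> \<eta>"
    proof -
      have "\<eta> * K \<le> \<eta> * (\<bar>K\<bar> + 1)" using \<eta> by (intro mult_left_mono) auto
      then show ?thesis by (simp add: field_simps)
    qed
    moreover have "0 < \<eta> / (\<bar>K\<bar> + 1)" using \<eta> by (intro divide_pos_pos) auto
    ultimately show "0 \<le> Re (block_form k P n x x) + 2 * Re (block_form k Y m x x) + \<eta>"
      using main[of "\<eta> / (\<bar>K\<bar> + 1)"] by linarith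
  qed
qed


section \<open>From operators to forms\<close>

lemma hermitian_form_cinner: "hermitian_form (cinner :: 'a::chilbert_space \<Rightarrow> 'a \<Rightarrow> complex)"
proof
  fix x y z :: 'a and c
  show "cinner (x + y) z = cinner x z + cinner y z" by (rule cinner_add_left)
  show "cinner (c *\<^sub>C x) y = c * cinner x y" by (rule cinner_scaleC_left)
  show "cinner x y = cnj (cinner y x)" by (rule cinner_commute)
  show "cinner x (y + z) = cinner x y + cinner x z"
    by (subst (1 2 3) cinner_commute) (simp add: cinner_add_left)
  show "cinner x (c *\<^sub>C y) = cnj c * cinner x y"
    by (subst (1 2) cinner_commute) (simp add: cinner_scaleC_left)
qed

interpretation cinner: hermitian_form "cinner :: 'a::chilbert_space \<Rightarrow> 'a \<Rightarrow> complex"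
  by (rule hermitian_form_cinner)

lemma sesquilinear_cinner_op:
  assumes "bounded_clinear B"
  shows "sesquilinear (\<lambda>u v. cinner (B u) v)"
proof -
  have "B (u + v) = B u + B v" "B (c *\<^sub>C u) = c *\<^sub>C B u" for u v c
    using assms linear_add[of B] by (auto simp: bounded_clinear_def bounded_linear.linear)
  then show ?thesis by unfold_locales (simp_all add: cinner.expand)
qed

lemma sesquilinear_cinner_matrix: "sesquilinear (\<lambda>u v. cinner ((A :: complex^'n^'n) *v u) v)"
proof -
  have "A *v (c *\<^sub>C u) = c *\<^sub>C (A *v u)" for c u
    by (simp add: vec_eq_iff matrix_vector_mult_def scaleC_vec_def scaleC_complex_def
        sum_distrib_left algebra_simps)
  then show ?thesis
    by unfold_locales (simp_all add: cinner.expand matrix_vector_right_distrib)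
qed

lemma cinner_conj_transpose: "cinner (conj_transpose A *v u) v = cnj (cinner (A *v v) u)"
  for A :: "complex^'n^'n"
proof -
  have "cinner (conj_transpose A *v u) v = (\<Sum>i\<in>UNIV. \<Sum>j\<in>UNIV. cnj (A $ j $ i) * u $ j * cnj (v $ i))"
    by (simp add: cinner_vec_def cinner_complex_def matrix_vector_mult_def conj_transpose_def
        map_matrix_def transpose_def sum_distrib_right)
  also have "\<dots> = (\<Sum>j\<in>UNIV. \<Sum>i\<in>UNIV. cnj (A $ j $ i) * u $ j * cnj (v $ i))" by (rule sum.swap)
  also have "\<dots> = cnj (cinner (A *v v) u)"
    by (simp add: cinner_vec_def cinner_complex_def matrix_vector_mult_def sum_distrib_right
        sum_distrib_left algebra_simps)
  finally show ?thesis .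
qed

lemma cinner_cadjoint:
  "bounded_clinear B \<Longrightarrow> cinner (cadjoint B u) v = cnj (cinner (B v) u)"
  by (subst cinner_commute) (simp add: cadjoint_works)

lemma mem_op_system_iff:
  "T \<in> op_system A \<longleftrightarrow> (\<exists>a b c. T = a *\<^sub>C mat 1 + b *\<^sub>C A + c *\<^sub>C conj_transpose A)"
  unfolding op_system_def complex_vector.span_insert complex_vector.span_empty
  by (auto simp: algebra_simps)

lemma op_system_mult_vec:
  "(a *\<^sub>C mat 1 + b *\<^sub>C A + c *\<^sub>C conj_transpose A) *v u =
    a *\<^sub>C u + b *\<^sub>C (A *v u) + c *\<^sub>C (conj_transpose A *v u)" for A :: "complex^'n^'n"
proof -
  have "(a *\<^sub>C M) *v u = a *\<^sub>C (M *v u)" for a and M :: "complex^'n^'n"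
    by (simp add: vec_eq_iff matrix_vector_mult_def scaleC_vec_def scaleC_complex_def
        sum_distrib_left algebra_simps)
  then show ?thesis by (simp add: matrix_vector_mult_add_rdistrib)
qed

lemma completely_positive_imp_positive_map:
  assumes "completely_positive_map S \<Phi>"
  shows "positive_map S \<Phi>"
  unfolding positive_map_def
proof (intro ballI impI)
  fix T assume T: "T \<in> S" "positive_op ((*v) T)"
  have "positive_block 1 (\<lambda>i j. \<Phi> T)"
    using assms[unfolded completely_positive_map_def, rule_format, of 1 "\<lambda>i j. T"] T
    by (simp add: positive_block_def block_cinner_def block_op_def positive_op_def)
  then show "positive_op (\<Phi> T)"
    by (fastforce simp: positive_block_def block_cinner_def block_op_def positive_op_def)
qed

lemma positive_map_on_hermitian:
  assumes B: "bounded_clinear B" and \<Phi>: "induced_map A B \<Phi>" and pos: "positive_map (op_system A) \<Phi>"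
    and nn: "\<And>\<xi>. 0 \<le> a * Re (cinner \<xi> \<xi>) + 2 * Re (b * cinner (A *v \<xi>) \<xi>)"
  shows "0 \<le> a * Re (cinner y y) + 2 * Re (b * cinner (B y) y)"
proof -
  define T where "T = complex_of_real a *\<^sub>C mat 1 + b *\<^sub>C A + cnj b *\<^sub>C conj_transpose A"
  have "cinner (T *v \<xi>) \<xi> = of_real (a * Re (cinner \<xi> \<xi>) + 2 * Re (b * cinner (A *v \<xi>) \<xi>))" for \<xi>
    unfolding T_def op_system_mult_vec cinner.expand cinner_conj_transpose
    using cinner.self_real[of \<xi>] by (simp add: complex_eq_iff)
  then have "positive_op ((*v) T)"
    unfolding positive_op_def using nn by (simp only: nonneg_Reals_of_real_iff simp_thms)
  moreover have "T \<in> op_system A" unfolding mem_op_system_iff T_def by blast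
  ultimately have "positive_op (\<Phi> T)" using pos by (auto simp: positive_map_def)
  moreover have "\<Phi> T = (\<lambda>x. complex_of_real a *\<^sub>C x + b *\<^sub>C B x + cnj b *\<^sub>C cadjoint B x)"
    using \<Phi> unfolding induced_map_def T_def by blast
  ultimately have "0 \<le> Re (cinner (complex_of_real a *\<^sub>C y + b *\<^sub>C B y + cnj b *\<^sub>C cadjoint B y) y)"
    by (simp add: positive_op_def complex_nonneg_Reals_iff)
  then show ?thesis
    unfolding cinner.expand cinner_cadjoint[OF B] using cinner.self_real[of y] by simp
qed

lemma block_cinner_eq_block_form:
  "block_cinner k (block_op k (\<lambda>i j u. P i j *\<^sub>C u + Y i j *\<^sub>C f u + Z i j *\<^sub>C g u) x) x =
    block_form k P cinner x x + block_form k Y (\<lambda>u v. cinner (f u) v) x x +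
    block_form k Z (\<lambda>u v. cinner (g u) v) x x"
  by (simp add: block_cinner_def block_op_def block_form_def cinner.sum_left cinner.expand sum.distrib)

text \<open>
  Multiplying by \<open>c \<in> {1, \<i>, - \<i>}\<close> and taking the Hermitian part of the coefficients reduces
  the nonnegativity of a complex number, including the vanishing of its imaginary part, to the case
  of Hermitian coefficients.
\<close>

lemma Re_block_form_hermitian_part:
  assumes "\<And>u v. s u v = cnj (s v u)"
  shows "Re (c * (block_form k P s x x + block_form k Y m x x + block_form k Z (\<lambda>u v. cnj (m v u)) x x)) =
    Re (block_form k (\<lambda>i j. (1 / 2) * (c * P i j + cnj (c * P j i))) s x x) +
    2 * Re (block_form k (\<lambda>i j. (1 / 2) * (c * Y i j + cnj (c * Z j i))) m x x)"
proof -
  have "block_form k (\<lambda>i j. cnj (c * P j i)) s x x = cnj (c * block_form k P s x x)"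
    using block_form_adjoint_coeff[of k "\<lambda>i j. c * P i j" s x x]
    by (simp only: assms[symmetric] block_form_scale_coeff)
  moreover have "block_form k (\<lambda>i j. cnj (c * Z j i)) m x x =
      cnj (c * block_form k Z (\<lambda>u v. cnj (m v u)) x x)"
    using block_form_adjoint_coeff[of k "\<lambda>i j. c * Z i j" m x x]
    by (simp only: block_form_scale_coeff)
  ultimately show ?thesis
    unfolding block_form_scale_coeff block_form_add_coeff
    by (simp add: algebra_simps add_divide_distrib diff_divide_distrib)
qed

lemma completely_positive_map_if_hermitian_coeffs:
  fixes A :: "complex^'n^'n" and B :: "'h::chilbert_space \<Rightarrow> 'h"
  assumes B: "bounded_clinear B" and \<Phi>: "induced_map A B \<Phi>"
    and main: "\<And>k P Y x. (\<And>i j. P i j = cnj (P j i)) \<Longrightarrow>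
      (\<And>\<xi>. 0 \<le> Re (block_form k P cinner \<xi> \<xi>) + 2 * Re (block_form k Y (\<lambda>u v. cinner (A *v u) v) \<xi> \<xi>)) \<Longrightarrow>
      0 \<le> Re (block_form k P cinner x x) + 2 * Re (block_form k Y (\<lambda>u v. cinner (B u) v) x x)"
  shows "completely_positive_map (op_system A) \<Phi>"
  unfolding completely_positive_map_def
proof (intro allI impI)
  fix k :: nat and T :: "nat \<Rightarrow> nat \<Rightarrow> complex^'n^'n"
  assume "1 \<le> k" and T: "\<forall>i<k. \<forall>j<k. T i j \<in> op_system A"
    and Tpos: "positive_block k (\<lambda>i j. (*v) (T i j))"
  have "\<forall>i j. \<exists>a b c. i < k \<longrightarrow> j < k \<longrightarrow> T i j = a *\<^sub>C mat 1 + b *\<^sub>C A + c *\<^sub>C conj_transpose A"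
    using T unfolding mem_op_system_iff by blast
  then obtain P Y Z where PYZ: "\<And>i j. i < k \<Longrightarrow> j < k \<Longrightarrow>
      T i j = P i j *\<^sub>C mat 1 + Y i j *\<^sub>C A + Z i j *\<^sub>C conj_transpose A" by metis
  define FA where "FA \<xi> = block_form k P cinner \<xi> \<xi> + block_form k Y (\<lambda>u v. cinner (A *v u) v) \<xi> \<xi> +
    block_form k Z (\<lambda>u v. cnj (cinner (A *v v) u)) \<xi> \<xi>" for \<xi>
  define FB where "FB x = block_form k P cinner x x + block_form k Y (\<lambda>u v. cinner (B u) v) x x +
    block_form k Z (\<lambda>u v. cnj (cinner (B v) u)) x x" for x
  have "block_cinner k (block_op k (\<lambda>i j. (*v) (T i j)) \<xi>) \<xi> = FA \<xi>" for \<xi>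
  proof -
    have "block_cinner k (block_op k (\<lambda>i j. (*v) (T i j)) \<xi>) \<xi> =
      block_cinner k (block_op k (\<lambda>i j u. P i j *\<^sub>C u + Y i j *\<^sub>C (A *v u) + Z i j *\<^sub>C (conj_transpose A *v u)) \<xi>) \<xi>"
      unfolding block_cinner_def block_op_def by (simp add: PYZ op_system_mult_vec)
    then show ?thesis by (simp add: block_cinner_eq_block_form FA_def cinner_conj_transpose)
  qed
  then have FA: "0 \<le> Re (FA \<xi>)" "Im (FA \<xi>) = 0" for \<xi>
    using Tpos by (auto simp: positive_block_def complex_nonneg_Reals_iff)
  have FB: "block_cinner k (block_op k (\<lambda>i j. \<Phi> (T i j)) x) x = FB x" for x
  proof -
    have "\<Phi> (T i j) = (\<lambda>u. P i j *\<^sub>C u + Y i j *\<^sub>C B u + Z i j *\<^sub>C cadjoint B u)" if "i < k" "j < k" for i j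
      using \<Phi> PYZ[OF that] unfolding induced_map_def by simp
    then have "block_cinner k (block_op k (\<lambda>i j. \<Phi> (T i j)) x) x =
      block_cinner k (block_op k (\<lambda>i j u. P i j *\<^sub>C u + Y i j *\<^sub>C B u + Z i j *\<^sub>C cadjoint B u) x) x"
      unfolding block_cinner_def block_op_def by simp
    then show ?thesis by (simp add: block_cinner_eq_block_form FB_def cinner_cadjoint[OF B])
  qed
  have step: "0 \<le> Re (c * FB x)" if "\<And>\<xi>. 0 \<le> Re (c * FA \<xi>)" for c x
    using that unfolding FA_def FB_def Re_block_form_hermitian_part[OF cinner.commute]
    by (intro main) simp_all
  have "0 \<le> Re (FB x)" for x using step[of 1 x] FA by simp
  moreover have "Im (FB x) = 0" for x using step[of \<i> x] step[of "- \<i>" x] FA by simp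
  ultimately show "positive_block k (\<lambda>i j. \<Phi> (T i j))"
    unfolding positive_block_def FB by (simp add: complex_nonneg_Reals_iff)
qed

text \<open>
  Here \<open>A\<close> has the matrix \<open>[[\<alpha>, \<beta>], [\<gamma>, \<alpha>]] \<oplus> [\<mu>]\<close> in an orthonormal basis \<open>f1, f2, f3\<close>, or
  \<open>[[\<alpha>, \<beta>], [\<gamma>, \<alpha>]]\<close> in an orthonormal basis \<open>f1, f2\<close> with \<open>f3 = f1\<close> and \<open>\<mu> = \<alpha>\<close>; \<open>s, t, r\<close> are the
  coordinates of \<open>\<xi>\<close>.
\<close>

lemma positive_imp_completely_positive:
  fixes A :: "complex^'n^'n" and B :: "'h::chilbert_space \<Rightarrow> 'h"
  assumes B: "bounded_clinear B" and \<Phi>: "induced_map A B \<Phi>" and pos: "positive_map (op_system A) \<Phi>"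
    and \<beta>\<gamma>: "cmod \<gamma> \<le> cmod \<beta>"
    and f: "cinner f1 f1 = 1" "cinner f2 f2 = 1" "cinner f1 f2 = 0" "cinner f3 f3 = 1"
    and Af: "cinner (A *v f1) f1 = \<alpha>" "cinner (A *v f2) f2 = \<alpha>" "cinner (A *v f2) f1 = \<beta>"
      "cinner (A *v f1) f2 = \<gamma>" "cinner (A *v f3) f3 = \<mu>"
    and coord: "\<And>\<xi>. \<exists>s t r. Re (cinner \<xi> \<xi>) = (cmod s)\<^sup>2 + (cmod t)\<^sup>2 + (cmod r)\<^sup>2 \<and>
      cinner (A *v \<xi>) \<xi> = \<alpha> * of_real ((cmod s)\<^sup>2 + (cmod t)\<^sup>2) + \<beta> * (t * cnj s) + \<gamma> * (s * cnj t) +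
        \<mu> * of_real ((cmod r)\<^sup>2)"
  shows "completely_positive_map (op_system A) \<Phi>"
proof (rule completely_positive_map_if_hermitian_coeffs[OF B \<Phi>])
  fix k P Y x
  assume herm: "\<And>i j. P i j = cnj (P j i)"
    and nn: "\<And>\<xi>. 0 \<le> Re (block_form k P cinner \<xi> \<xi>) + 2 * Re (block_form k Y (\<lambda>u v. cinner (A *v u) v) \<xi> \<xi>)"
  interpret A: sesquilinear "\<lambda>u v. cinner (A *v u) v" by (rule sesquilinear_cinner_matrix)
  have f21: "cinner f2 f1 = 0" using f(3) cinner.commute[of f2 f1] by simp
  show "0 \<le> Re (block_form k P cinner x x) + 2 * Re (block_form k Y (\<lambda>u v. cinner (B u) v) x x)"
  proof (rule equal_diagonal_positive[OF hermitian_form_cinner sesquilinear_cinner_op[OF B] \<beta>\<gamma> _ herm])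
    fix a b and y :: 'h
    assume a1: "cmod (b * \<beta> + cnj b * cnj \<gamma>) \<le> a + 2 * Re (b * \<alpha>)" and a2: "0 \<le> a + 2 * Re (b * \<mu>)"
    show "0 \<le> a * Re (cinner y y) + 2 * Re (b * cinner (B y) y)"
    proof (rule positive_map_on_hermitian[OF B \<Phi> pos])
      fix \<xi>
      obtain s t r where str: "Re (cinner \<xi> \<xi>) = (cmod s)\<^sup>2 + (cmod t)\<^sup>2 + (cmod r)\<^sup>2"
        "cinner (A *v \<xi>) \<xi> = \<alpha> * of_real ((cmod s)\<^sup>2 + (cmod t)\<^sup>2) + \<beta> * (t * cnj s) + \<gamma> * (s * cnj t) +
        \<mu> * of_real ((cmod r)\<^sup>2)" using coord by blast
      define w where "w = b * \<beta> + cnj b * cnj \<gamma>"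
      define S where "S = (cmod s)\<^sup>2 + (cmod t)\<^sup>2"
      have "b * cinner (A *v \<xi>) \<xi> = b * \<alpha> * of_real S + b * \<beta> * (t * cnj s) +
          cnj (cnj b * cnj \<gamma> * (t * cnj s)) + b * \<mu> * of_real ((cmod r)\<^sup>2)"
        by (simp add: str S_def algebra_simps)
      moreover have "Re (y * of_real c) = Re y * c" for y c by simp
      ultimately have "Re (b * cinner (A *v \<xi>) \<xi>) = Re (b * \<alpha>) * S + Re (w * (t * cnj s)) + Re (b * \<mu>) * (cmod r)\<^sup>2"
        by (simp only: plus_complex.sel cnj.sel w_def distrib_right)
      moreover have "- (cmod w * S) \<le> 2 * Re (w * (t * cnj s))"
      proof -
        have "2 * \<bar>Re (w * (t * cnj s))\<bar> \<le> cmod w * (2 * cmod s * cmod t)"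
          using abs_Re_le_cmod[of "w * (t * cnj s)"] by (simp add: norm_mult algebra_simps)
        also have "\<dots> \<le> cmod w * S"
          unfolding S_def by (intro mult_left_mono sum_squares_bound) auto
        finally show ?thesis by linarith
      qed
      moreover have "cmod w * S \<le> (a + 2 * Re (b * \<alpha>)) * S"
        using a1 unfolding w_def S_def by (intro mult_right_mono) auto
      moreover have "0 \<le> (a + 2 * Re (b * \<mu>)) * (cmod r)\<^sup>2" using a2 by (intro mult_nonneg_nonneg) auto
      ultimately show "0 \<le> a * Re (cinner \<xi> \<xi>) + 2 * Re (b * cinner (A *v \<xi>) \<xi>)"
        unfolding str(1) S_def[symmetric] by (simp add: algebra_simps)
    qed
  next
    fix a b :: "nat \<Rightarrow> complex"
    define \<xi> where "\<xi> j = a j *\<^sub>C f1 + b j *\<^sub>C f2" for j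
    have "block_form k P cinner \<xi> \<xi> = block_form k P mult_cnj a a + block_form k P mult_cnj b b"
      by (simp add: block_form_def \<xi>_def cinner.expand f f21 algebra_simps sum.distrib)
    moreover have "block_form k Y (\<lambda>u v. cinner (A *v u) v) \<xi> \<xi> =
        \<alpha> * block_form k Y mult_cnj a a + \<alpha> * block_form k Y mult_cnj b b +
        (\<beta> * block_form k Y mult_cnj b a + \<gamma> * block_form k Y mult_cnj a b)"
      unfolding block_form_def \<xi>_def A.expand Af
      by (simp add: algebra_simps sum.distrib sum_distrib_left)
    ultimately show "0 \<le> Re (block_form k P mult_cnj a a) + 2 * Re (\<alpha> * block_form k Y mult_cnj a a) +
      Re (block_form k P mult_cnj b b) + 2 * Re (\<alpha> * block_form k Y mult_cnj b b) +
      2 * Re (\<beta> * block_form k Y mult_cnj b a + \<gamma> * block_form k Y mult_cnj a b)"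
      using nn[of \<xi>] by (simp only: plus_complex.sel) (simp add: algebra_simps)
  next
    fix a :: "nat \<Rightarrow> complex"
    define \<xi> where "\<xi> j = a j *\<^sub>C f3" for j
    have "block_form k P cinner \<xi> \<xi> = block_form k P mult_cnj a a"
      by (simp add: block_form_def \<xi>_def cinner.expand f algebra_simps)
    moreover have "block_form k Y (\<lambda>u v. cinner (A *v u) v) \<xi> \<xi> = \<mu> * block_form k Y mult_cnj a a"
      by (simp add: block_form_def \<xi>_def A.expand Af algebra_simps sum_distrib_left)
    ultimately show "0 \<le> Re (block_form k P mult_cnj a a) + 2 * Re (\<mu> * block_form k Y mult_cnj a a)"
      using nn[of \<xi>] by simp
  qed
qed


section \<open>Two-by-two matrices with equal diagonal entries\<close>

text \<open>For \<open>A = [[p, q], [r, p']]\<close> and \<open>d = (p - p') / 2\<close> a solution \<open>w\<close> makes the value of the quadratic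
  form of \<open>A\<close> at the normalisation of \<open>(1, w)\<close> equal to half the trace.\<close>

lemma equal_diagonal_equation:
  fixes d q r :: complex
  shows "\<exists>w. d * (1 - w * cnj w) + q * w + r * cnj w = 0"
proof (cases "d = 0")
  case True
  then show ?thesis by (intro exI[of _ 0]) simp
next
  case False
  define q' r' where "q' = q / d" and "r' = r / d"
  \<comment> \<open>On a suitable real line through the origin the equation divided by \<open>d\<close> is real quadratic.\<close>
  obtain v where v: "v \<noteq> 0" "Im (q' * v + r' * cnj v) = 0"
  proof (cases "Complex (Re q' - Re r') (- (Im q' + Im r')) = 0")
    case True
    then show ?thesis by (intro that[of 1]) (auto simp: complex_eq_iff)
  next
    case False
    then show ?thesis by (intro that[of "Complex (Re q' - Re r') (- (Im q' + Im r'))"]) (auto simp: algebra_simps)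
  qed
  define s where "s = Re (q' * v + r' * cnj v)"
  define N where "N = (cmod v)\<^sup>2"
  have N: "N > 0" using v by (simp add: N_def)
  define t where "t = (s + sqrt (s\<^sup>2 + 4 * N)) / (2 * N)"
  have "(2 * N * t - s)\<^sup>2 = s\<^sup>2 + 4 * N" using N by (simp add: t_def)
  then have "4 * N * (1 - N * t\<^sup>2 + t * s) = 0" by (simp add: power2_eq_square algebra_simps)
  then have t: "1 - N * t\<^sup>2 + t * s = 0" using N by simp
  have s: "q' * v + r' * cnj v = of_real s" using v(2) by (simp add: s_def complex_eq_iff)
  have N': "v * cnj v = of_real N" by (simp only: N_def complex_norm_square)
  define w where "w = of_real t * v"
  have "1 - w * cnj w + q' * w + r' * cnj w = 1 - (v * cnj v) * of_real (t\<^sup>2) + of_real t * (q' * v + r' * cnj v)"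
    by (simp add: w_def power2_eq_square algebra_simps)
  also have "\<dots> = of_real (1 - N * t\<^sup>2 + t * s)" unfolding s N' by simp
  finally have "1 - w * cnj w + q' * w + r' * cnj w = 0" using t by simp
  then have "d * (1 - w * cnj w + q' * w + r' * cnj w) = 0" by simp
  then show ?thesis
    using False by (intro exI[of _ w]) (simp add: q'_def r'_def distrib_left)
qed

lemma equal_diagonal_basis:
  fixes A :: "complex^2^2"
  obtains f1 f2 where "cinner f1 f1 = 1" "cinner f2 f2 = 1" "cinner f1 f2 = 0"
    "\<And>\<xi>. \<xi> = cinner \<xi> f1 *\<^sub>C f1 + cinner \<xi> f2 *\<^sub>C f2"
    "cinner (A *v f1) f1 = cinner (A *v f2) f2" "cmod (cinner (A *v f1) f2) \<le> cmod (cinner (A *v f2) f1)"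
proof -
  define d where "d = (A $ 1 $ 1 - A $ 2 $ 2) / 2"
  obtain w where w: "d * (1 - w * cnj w) + A $ 1 $ 2 * w + A $ 2 $ 1 * cnj w = 0"
    using equal_diagonal_equation by blast
  define t where "t = complex_of_real (1 / sqrt (1 + (cmod w)\<^sup>2))"
  have t_cnj: "cnj t = t" by (simp add: t_def)
  have "0 < 1 + (cmod w)\<^sup>2" by (simp add: add_pos_nonneg)
  then have "1 / sqrt (1 + (cmod w)\<^sup>2) * (1 / sqrt (1 + (cmod w)\<^sup>2)) * (1 + (cmod w)\<^sup>2) = 1"
    by (simp add: field_simps flip: power2_eq_square)
  then have "t * t * complex_of_real (1 + (cmod w)\<^sup>2) = 1"
    unfolding t_def of_real_mult[symmetric] by (simp only: of_real_1)
  then have tt: "t * t * (1 + w * cnj w) = 1" by (simp only: of_real_add of_real_1 complex_norm_square)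
  define f1 f2 :: "complex^2" where "f1 = vector [t, t * w]" and "f2 = vector [- (t * cnj w), t]"
  note defs = f1_def f2_def cinner_vec_def cinner_complex_def sum_2 vector_2 t_cnj
  have 1: "cinner f1 f1 = 1" "cinner f2 f2 = 1" "cinner f1 f2 = 0"
    using tt by (simp_all add: defs algebra_simps)
  have 2: "\<xi> = cinner \<xi> f1 *\<^sub>C f1 + cinner \<xi> f2 *\<^sub>C f2" for \<xi>
  proof -
    have "cinner \<xi> f1 * t + cinner \<xi> f2 * - (t * cnj w) = \<xi> $ 1 * (t * t * (1 + w * cnj w))"
      "cinner \<xi> f1 * (t * w) + cinner \<xi> f2 * t = \<xi> $ 2 * (t * t * (1 + w * cnj w))"
      by (simp_all add: defs algebra_simps)
    then show ?thesis
      unfolding tt by (simp add: vec_eq_iff forall_2 scaleC_vec_def scaleC_complex_def f1_def f2_def)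
  qed
  have "cinner (A *v f1) f1 - cinner (A *v f2) f2 =
      2 * (t * t) * (d * (1 - w * cnj w) + A $ 1 $ 2 * w + A $ 2 $ 1 * cnj w)"
    by (simp add: defs matrix_vector_mult_def d_def field_simps)
  then have 3: "cinner (A *v f1) f1 = cinner (A *v f2) f2" using w by simp
  show thesis
  proof (cases "cmod (cinner (A *v f1) f2) \<le> cmod (cinner (A *v f2) f1)")
    case True
    then show ?thesis using that[of f1 f2] 1 2 3 by blast
  next
    case False
    have "cinner f2 f1 = 0" using 1(3) cinner.commute[of f2 f1] by simp
    moreover have "\<xi> = cinner \<xi> f2 *\<^sub>C f2 + cinner \<xi> f1 *\<^sub>C f1" for \<xi>
      using 2[of \<xi>] by (simp add: add.commute)
    ultimately show ?thesis using that[of f2 f1] 1(1,2) 3 False by simp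
  qed
qed

lemma equal_diagonal_coordinates:
  fixes A :: "complex^'n^'n"
  assumes "cinner f1 f1 = 1" "cinner f2 f2 = 1" "cinner f1 f2 = 0"
    and \<xi>: "\<xi> = s *\<^sub>C f1 + t *\<^sub>C f2"
    and "cinner (A *v f1) f1 = \<alpha>" "cinner (A *v f2) f2 = \<alpha>"
  shows "Re (cinner \<xi> \<xi>) = (cmod s)\<^sup>2 + (cmod t)\<^sup>2"
    "cinner (A *v \<xi>) \<xi> = \<alpha> * of_real ((cmod s)\<^sup>2 + (cmod t)\<^sup>2) +
      cinner (A *v f2) f1 * (t * cnj s) + cinner (A *v f1) f2 * (s * cnj t)"
proof -
  interpret A: sesquilinear "\<lambda>u v. cinner (A *v u) v" by (rule sesquilinear_cinner_matrix)
  have "cinner f2 f1 = 0" using assms(3) cinner.commute[of f2 f1] by simp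
  then have "cinner \<xi> \<xi> = s * cnj s + t * cnj t" unfolding \<xi> by (simp add: cinner.expand assms(1-3))
  then show "Re (cinner \<xi> \<xi>) = (cmod s)\<^sup>2 + (cmod t)\<^sup>2"
    by (simp only: complex_norm_square[symmetric] plus_complex.sel Re_complex_of_real)
  show "cinner (A *v \<xi>) \<xi> = \<alpha> * of_real ((cmod s)\<^sup>2 + (cmod t)\<^sup>2) +
      cinner (A *v f2) f1 * (t * cnj s) + cinner (A *v f1) f2 * (s * cnj t)"
    unfolding \<xi> A.expand assms(5,6) of_real_add complex_norm_square by (simp add: algebra_simps)
qed

lemma cinner_direct_sum_scalar:
  "cinner (direct_sum_scalar A \<mu> *v \<xi>) \<zeta> =
    cinner (A *v vector [\<xi> $ 1, \<xi> $ 2]) (vector [\<zeta> $ 1, \<zeta> $ 2]) + \<mu> * (\<xi> $ 3 * cnj (\<zeta> $ 3))"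
  by (simp add: cinner_vec_def cinner_complex_def sum_2 sum_3 matrix_vector_mult_def
      direct_sum_scalar_def algebra_simps)

lemma cinner_vec_3:
  "cinner \<xi> \<zeta> = cinner (vector [\<xi> $ 1, \<xi> $ 2] :: complex^2) (vector [\<zeta> $ 1, \<zeta> $ 2]) + \<xi> $ 3 * cnj (\<zeta> $ 3)"
  for \<xi> \<zeta> :: "complex^3"
  by (simp add: cinner_vec_def cinner_complex_def sum_2 sum_3)

theorem theorem1p4:
  fixes A0 :: "complex ^ 2 ^ 2" and \<mu> :: complex
    and B :: "'h::chilbert_space \<Rightarrow> 'h"
  assumes "bounded_clinear B"
  shows "(\<forall>\<Phi> :: complex ^ 2 ^ 2 \<Rightarrow> 'h \<Rightarrow> 'h. induced_map A0 B \<Phi> \<longrightarrow>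
            (positive_map (op_system A0) \<Phi> \<longleftrightarrow> completely_positive_map (op_system A0) \<Phi>))
       \<and> (\<forall>\<Phi> :: complex ^ 3 ^ 3 \<Rightarrow> 'h \<Rightarrow> 'h. induced_map (direct_sum_scalar A0 \<mu>) B \<Phi> \<longrightarrow>
            (positive_map (op_system (direct_sum_scalar A0 \<mu>)) \<Phi> \<longleftrightarrow>
             completely_positive_map (op_system (direct_sum_scalar A0 \<mu>)) \<Phi>))"
proof -
  obtain f1 f2 where f: "cinner f1 f1 = 1" "cinner f2 f2 = 1" "cinner f1 f2 = 0"
    and basis: "\<And>\<xi>. \<xi> = cinner \<xi> f1 *\<^sub>C f1 + cinner \<xi> f2 *\<^sub>C f2"
    and diag: "cinner (A0 *v f1) f1 = cinner (A0 *v f2) f2"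
    and off: "cmod (cinner (A0 *v f1) f2) \<le> cmod (cinner (A0 *v f2) f1)"
    using equal_diagonal_basis[of A0] by metis
  define \<alpha> where "\<alpha> = cinner (A0 *v f1) f1"
  have \<alpha>: "cinner (A0 *v f1) f1 = \<alpha>" "cinner (A0 *v f2) f2 = \<alpha>" by (simp_all add: \<alpha>_def diag)
  note coordinates = equal_diagonal_coordinates[OF f basis \<alpha>]
  have two: "completely_positive_map (op_system A0) \<Phi>"
    if \<Phi>: "induced_map A0 B \<Phi>" "positive_map (op_system A0) \<Phi>" for \<Phi> :: "complex ^ 2 ^ 2 \<Rightarrow> 'h \<Rightarrow> 'h"
  proof (rule positive_imp_completely_positive[OF assms \<Phi> off f f(1) \<alpha> refl refl \<alpha>(1)])
    fix \<xi>
    show "\<exists>s t r. Re (cinner \<xi> \<xi>) = (cmod s)\<^sup>2 + (cmod t)\<^sup>2 + (cmod r)\<^sup>2 \<and>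
        cinner (A0 *v \<xi>) \<xi> = \<alpha> * of_real ((cmod s)\<^sup>2 + (cmod t)\<^sup>2) + cinner (A0 *v f2) f1 * (t * cnj s) +
          cinner (A0 *v f1) f2 * (s * cnj t) + \<alpha> * of_real ((cmod r)\<^sup>2)"
      using coordinates[of \<xi>]
      by (intro exI[of _ "cinner \<xi> f1"] exI[of _ "cinner \<xi> f2"] exI[of _ 0]) simp
  qed
  define g1 g2 g3 :: "complex^3" where "g1 = vector [f1 $ 1, f1 $ 2, 0]"
    and "g2 = vector [f2 $ 1, f2 $ 2, 0]" and "g3 = vector [0, 0, 1]"
  have eta: "vector [u $ 1, u $ 2] = u" for u :: "complex^2"
    by (simp add: vec_eq_iff forall_2)
  have zero: "vector [0, 0] = (0 :: complex^2)" by (simp add: vec_eq_iff forall_2)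
  have three: "completely_positive_map (op_system (direct_sum_scalar A0 \<mu>)) \<Phi>"
    if \<Phi>: "induced_map (direct_sum_scalar A0 \<mu>) B \<Phi>" "positive_map (op_system (direct_sum_scalar A0 \<mu>)) \<Phi>"
    for \<Phi> :: "complex ^ 3 ^ 3 \<Rightarrow> 'h \<Rightarrow> 'h"
  proof (rule positive_imp_completely_positive[OF assms \<Phi> off])
    show "cinner g1 g1 = 1" "cinner g2 g2 = 1" "cinner g1 g2 = 0" "cinner g3 g3 = 1"
      by (simp_all add: cinner_vec_3 g1_def g2_def g3_def eta zero f)
    show "cinner (direct_sum_scalar A0 \<mu> *v g1) g1 = \<alpha>" "cinner (direct_sum_scalar A0 \<mu> *v g2) g2 = \<alpha>"
      "cinner (direct_sum_scalar A0 \<mu> *v g2) g1 = cinner (A0 *v f2) f1"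
      "cinner (direct_sum_scalar A0 \<mu> *v g1) g2 = cinner (A0 *v f1) f2"
      "cinner (direct_sum_scalar A0 \<mu> *v g3) g3 = \<mu>"
      by (simp_all add: cinner_direct_sum_scalar g1_def g2_def g3_def eta zero \<alpha>)
  next
    fix \<xi> :: "complex^3"
    define \<zeta> :: "complex^2" where "\<zeta> = vector [\<xi> $ 1, \<xi> $ 2]"
    have "Re (cinner \<xi> \<xi>) = Re (cinner \<zeta> \<zeta>) + (cmod (\<xi> $ 3))\<^sup>2"
      unfolding \<zeta>_def by (subst cinner_vec_3) (simp only: complex_norm_square[symmetric] plus_complex.sel Re_complex_of_real)
    moreover have "cinner (direct_sum_scalar A0 \<mu> *v \<xi>) \<xi> = cinner (A0 *v \<zeta>) \<zeta> + \<mu> * of_real ((cmod (\<xi> $ 3))\<^sup>2)"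
      by (simp only: cinner_direct_sum_scalar \<zeta>_def complex_norm_square)
    ultimately show "\<exists>s t r. Re (cinner \<xi> \<xi>) = (cmod s)\<^sup>2 + (cmod t)\<^sup>2 + (cmod r)\<^sup>2 \<and>
        cinner (direct_sum_scalar A0 \<mu> *v \<xi>) \<xi> = \<alpha> * of_real ((cmod s)\<^sup>2 + (cmod t)\<^sup>2) +
          cinner (A0 *v f2) f1 * (t * cnj s) + cinner (A0 *v f1) f2 * (s * cnj t) + \<mu> * of_real ((cmod r)\<^sup>2)"
      using coordinates[of \<zeta>]
      by (intro exI[of _ "cinner \<zeta> f1"] exI[of _ "cinner \<zeta> f2"] exI[of _ "\<xi> $ 3"]) simp
  qed
  show ?thesis
    using two completely_positive_imp_positive_map[of "op_system A0"]
      three completely_positive_imp_positive_map[of "op_system (direct_sum_scalar A0 \<mu>)"] by blast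
qed

end
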